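(* Let $A$ be a $d\times d$ real symmetric positive definite matrix with minimum and maximum eigenvalues $m$ and $M$ such that $0<m<M<\infty$, let $y\in\mathbb{R}^d$, and let $f(x)=\frac12(Ax,x)-(x,y)$. Apply a $P$-gradient algorithm for the minimisation of $f$, initialized at $x_0$, with iterates $x_k$ and renormalised gradients $z_k=z(x_k)$. Assume that $$E_1 z_0\neq 0\quad\text{and}\quad E_d z_0\neq 0,$$ where $E_1$ and $E_d$ are the orthogonal projectors on the eigenspaces of $A$ associated with the eigenvalues $m$ and $M$ respectively. Then there exist a number $p\in(0,1)$, depending on $z_0$, and vectors $u_n,v_n\in\mathbb{R}^d$ ($n\ge 0$) such that for all $k\geq 0$ $$z_{2k}=\sqrt{p}\,u_{2k}+\sqrt{1-p}\,v_{2k},\qquad z_{2k+1}=\sqrt{1-p}\,u_{2k+1}-\sqrt{p}\,v_{2k+1},$$ with $\|u_n\|=\|v_n\|=1$ for all $n$, and $\|Au_n-mu_n\|\to 0$, $\|Av_n-Mv_n\|\to 0$ as $n\to\infty$.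
   Context: $(\cdot,\cdot)$ is the Euclidean inner product and $\|\cdot\|$ its norm. The gradient of $f$ is $g(x)=Ax-y$. Let $P(\cdot)$ be a real function on $[m,M]$, infinitely differentiable, with Laurent series $P(z)=\sum_{k=-\infty}^{\infty}c_kz^k$, $c_k\in\mathbb{R}$, such that $0<\sum_{k=-\infty}^\infty c_ka^k<\infty$ for all $a\in[m,M]$. The corresponding $P$-gradient algorithm is $x_{k+1}=x_k-\gamma_kg_k$, $g_k=g(x_k)$, where the step-length $\gamma_k$ minimizes $(P(A)g(x_k-\gamma g_k),g(x_k-\gamma g_k))$ with respect to $\gamma$, that is (for $g_k\ne0$) $$\gamma_k=\frac{(P(A)Ag_k,g_k)}{(P(A)A^2g_k,g_k)}.$$ The renormalised gradient at $x$ (with $g(x)\neq0$) is $$z(x)=\frac{Bg(x)}{(P(A)Ag(x),g(x))^{1/2}},$$ where $B=[P(A)A]^{1/2}$ is the positive square root of $P(A)A$; thus $\|z(x)\|=1$. *)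

theory Defs
  imports "HOL-Analysis.Analysis"
begin

section \<open>Symmetric matrices, eigenspaces, orthogonal projectors\<close>

definition pos_def_matrix :: "real^'n^'n \<Rightarrow> bool" where
  "pos_def_matrix A \<longleftrightarrow> transpose A = A \<and> (\<forall>v. v \<noteq> 0 \<longrightarrow> (A *v v) \<bullet> v > 0)"

definition pos_semidef_matrix :: "real^'n^'n \<Rightarrow> bool" where
  "pos_semidef_matrix A \<longleftrightarrow> transpose A = A \<and> (\<forall>v. (A *v v) \<bullet> v \<ge> 0)"

definition eigenspace :: "real^'n^'n \<Rightarrow> real \<Rightarrow> (real^'n) set" where
  "eigenspace A l = {v. A *v v = l *\<^sub>R v}"

definition eigenvalues :: "real^'n^'n \<Rightarrow> real set" where
  "eigenvalues A = {l. \<exists>v. v \<noteq> 0 \<and> v \<in> eigenspace A l}"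

definition orth_projector :: "'a::euclidean_space set \<Rightarrow> 'a \<Rightarrow> 'a" where
  "orth_projector S x = (THE w. w \<in> S \<and> (\<forall>s\<in>S. orthogonal (x - w) s))"

definition pos_sqrt_matrix :: "real^'n^'n \<Rightarrow> real^'n^'n" where
  "pos_sqrt_matrix C = (THE B. pos_semidef_matrix B \<and> B ** B = C)"

section \<open>Laurent series\<close>

text \<open>A two-sided series converges if both one-sided halves converge (not necessarily absolutely).\<close>

definition laurent_sums :: "(int \<Rightarrow> 'a::real_normed_vector) \<Rightarrow> 'a \<Rightarrow> bool" where
  "laurent_sums f s \<longleftrightarrow>
     (\<exists>s1 s2. (\<lambda>n. f (int n)) sums s1 \<and> (\<lambda>n. f (- int (Suc n))) sums s2 \<and> s = s1 + s2)"

definition laurent_suminf :: "(int \<Rightarrow> 'a::real_normed_vector) \<Rightarrow> 'a" where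
  "laurent_suminf f = (\<Sum>n. f (int n)) + (\<Sum>n. f (- int (Suc n)))"

lemma laurent_sums_unique:
  assumes "laurent_sums f s"
  shows "laurent_suminf f = s"
  using assms unfolding laurent_sums_def laurent_suminf_def
  by (auto dest!: sums_unique)

text \<open>The overloaded power on \<open>real^'n^'n\<close> is componentwise, so matrix powers are defined from
  the matrix product.\<close>

definition matrix_power_int :: "real^'n^'n \<Rightarrow> int \<Rightarrow> real^'n^'n" where
  "matrix_power_int A k =
     (if 0 \<le> k then (((**) A) ^^ nat k) (mat 1)
      else (((**) (matrix_inv A)) ^^ nat (- k)) (mat 1))"

text \<open>\<open>laurent_matrix c A\<close> is \<open>P(A)\<close>, where \<open>P\<close> is the Laurent series with coefficients \<open>c\<close>.\<close>

definition laurent_matrix :: "(int \<Rightarrow> real) \<Rightarrow> real^'n^'n \<Rightarrow> real^'n^'n" where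
  "laurent_matrix c A = laurent_suminf (\<lambda>k. c k *\<^sub>R matrix_power_int A k)"

text \<open>Derivatives at the endpoints of the interval are one-sided.\<close>

definition infinitely_differentiable_on :: "(real \<Rightarrow> real) \<Rightarrow> real set \<Rightarrow> bool" where
  "infinitely_differentiable_on P S \<longleftrightarrow>
     (\<exists>D :: nat \<Rightarrow> real \<Rightarrow> real. (\<forall>t\<in>S. D 0 t = P t) \<and>
        (\<forall>n. \<forall>t\<in>S. (D n has_real_derivative D (Suc n) t) (at t within S)))"

section \<open>Gradient algorithms for a quadratic function\<close>

definition quad_fun :: "real^'n^'n \<Rightarrow> real^'n \<Rightarrow> real^'n \<Rightarrow> real" where
  "quad_fun A y x = 1/2 * ((A *v x) \<bullet> x) - x \<bullet> y"

definition quad_grad :: "real^'n^'n \<Rightarrow> real^'n \<Rightarrow> real^'n \<Rightarrow> real^'n" where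
  "quad_grad A y x = A *v x - y"

lemma GDERIV_quad_fun:
  fixes A :: "real^'n^'n"
  assumes "transpose A = A"
  shows "GDERIV (quad_fun A y) x :> quad_grad A y x"
proof -
  have sym: "(A *v u) \<bullet> w = u \<bullet> (A *v w)" for u w :: "real^'n"
    using assms by (metis dot_lmul_matrix vector_transpose_matrix)
  have lin: "((*v) A has_derivative (*v) A) (at x)"
    by (rule bounded_linear.has_derivative[OF matrix_vector_mul_bounded_linear has_derivative_ident])
  have "(quad_fun A y has_derivative
      (\<lambda>h. 1/2 * ((A *v x) \<bullet> h + (A *v h) \<bullet> x) - h \<bullet> y)) (at x)"
    unfolding quad_fun_def
    by (auto intro!: derivative_eq_intros lin)
  moreover have "1/2 * ((A *v x) \<bullet> h + (A *v h) \<bullet> x) - h \<bullet> y = h \<bullet> quad_grad A y x" for h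
    by (simp add: quad_grad_def sym[of h x] inner_diff_right inner_commute[of "A *v x" h])
  ultimately show ?thesis
    unfolding gderiv_def by simp
qed

text \<open>\<open>Q\<close> plays the role of \<open>P(A)\<close>. When the gradient at \<open>x k\<close> vanishes, every step-length is a
  minimiser and the iterates stay at \<open>x k\<close>.\<close>

definition gradient_algorithm ::
  "real^'n^'n \<Rightarrow> real^'n \<Rightarrow> real^'n^'n \<Rightarrow> (nat \<Rightarrow> real^'n) \<Rightarrow> (nat \<Rightarrow> real) \<Rightarrow> bool" where
  "gradient_algorithm A y Q x \<gamma> \<longleftrightarrow>
     (\<forall>k. is_arg_min
            (\<lambda>t. (Q *v quad_grad A y (x k - t *\<^sub>R quad_grad A y (x k)))
                 \<bullet> quad_grad A y (x k - t *\<^sub>R quad_grad A y (x k)))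
            (\<lambda>_. True) (\<gamma> k) \<and>
          x (Suc k) = x k - \<gamma> k *\<^sub>R quad_grad A y (x k))"

text \<open>Equal to \<open>0\<close> (because \<open>1/0 = 0\<close>) when the gradient at \<open>x\<close> vanishes.\<close>

definition renorm_grad ::
  "real^'n^'n \<Rightarrow> real^'n \<Rightarrow> real^'n^'n \<Rightarrow> real^'n \<Rightarrow> real^'n" where
  "renorm_grad A y Q x =
     (1 / sqrt (((Q ** A) *v quad_grad A y x) \<bullet> quad_grad A y x)) *\<^sub>R
       (pos_sqrt_matrix (Q ** A) *v quad_grad A y x)"

end

theory Submission
  imports Defs
begin

text \<open>
  In an orthonormal eigenbasis \<open>b\<^sub>i\<close> of \<open>A\<close> with eigenvalues \<open>l\<^sub>i\<close>, the renormalised gradient evolves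
  independently of \<open>P\<close>: the weights \<open>w\<^sub>i = (z \<bullet> b\<^sub>i)\<^sup>2\<close> form a probability distribution on the spectrum,
  and one step multiplies \<open>w\<^sub>i\<close> by \<open>(l\<^sub>i - \<mu>)\<^sup>2 / V\<close>, where \<open>\<mu>\<close> and \<open>V\<close> are its mean and variance.
  With \<open>h(t) = (t - \<mu>\<^sub>k) (t - \<mu>\<^sub>k\<^sub>+\<^sub>1) - V\<^sub>k\<close> one has \<open>\<Sum>\<^sub>i w\<^sub>i h(l\<^sub>i)\<^sup>2 = V\<^sub>k (V\<^sub>k\<^sub>+\<^sub>1 - V\<^sub>k)\<close>. Hence \<open>V\<close> increases and
  converges, two consecutive steps asymptotically cancel, and every limit distribution lives on two
  eigenvalues \<open>\<alpha>\<close>, \<open>\<beta>\<close> with \<open>(c - \<alpha>) (\<beta> - c) = lim V\<close> for its mean \<open>c\<close>. So the means have finitely many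
  limit points, and since their two-step increments vanish, the means of even and of odd index
  converge. Two steps multiply \<open>w\<^sub>i\<close> by about \<open>(1 + h(l\<^sub>i) / V)\<^sup>2\<close>, and the weights at \<open>m\<close> and \<open>M\<close> never
  vanish, so the limit of \<open>h\<close> is nonpositive at \<open>m\<close> and \<open>M\<close>. By strict convexity it is negative in
  between, which forces all interior weights to \<open>0\<close>.
\<close>

section \<open>Spectral calculus for symmetric matrices\<close>

lemma symmetric_matrix_inner:
  fixes A :: "real^'n^'n"
  assumes "transpose A = A"
  shows "(A *v u) \<bullet> w = u \<bullet> (A *v w)"
  using assms by (metis dot_lmul_matrix vector_transpose_matrix)

text \<open>First-order condition at a maximum: for small positive \<open>t\<close> a positive
  linear term would outgrow the quadratic one.\<close>

lemma linear_term_zero: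
  fixes r K :: real
  assumes "\<And>t. 2 * t * r \<le> t^2 * K" and "r \<ge> 0"
  shows "r = 0"
proof (rule ccontr)
  assume "r \<noteq> 0"
  with assms have r: "r > 0" by simp
  define t where "t = r / (1 + \<bar>K\<bar>)"
  have t: "t > 0" using r by (simp add: t_def)
  have "2 * t * r \<le> t^2 * K" by fact
  hence "2 * r \<le> t * K" using t by (simp add: power2_eq_square mult.assoc mult.left_commute)
  also have "\<dots> \<le> t * (1 + \<bar>K\<bar>)" using t by (intro mult_left_mono) auto
  also have "\<dots> = r" by (simp add: t_def)
  finally show False using r by simp
qed

text \<open>A maximiser \<open>e\<close> of the Rayleigh quotient on the unit sphere of
  \<open>S\<close> is an eigenvector: its residual \<open>w\<close> lies in \<open>S\<close> and is
  orthogonal to \<open>e\<close>, so moving from \<open>e\<close> along \<open>w\<close> would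
  increase the quotient unless \<open>w = 0\<close>.\<close>

lemma symmetric_matrix_eigenvector_in_subspace:
  fixes A :: "real^'n^'n"
  assumes sym: "transpose A = A" and S: "subspace S" "S \<noteq> {0}" and inv: "\<And>x. x \<in> S \<Longrightarrow> A *v x \<in> S"
  shows "\<exists>e\<in>S. norm e = 1 \<and> (\<exists>l. A *v e = l *\<^sub>R e)"
proof -
  let ?K = "sphere 0 1 \<inter> S"
  have "compact ?K"
    by (intro compact_Int_closed closed_subspace S) auto
  moreover obtain x where x: "x \<in> S" "x \<noteq> 0" using S subspace_0 by blast
  hence "x /\<^sub>R norm x \<in> ?K" using S by (auto simp: subspace_scale)
  hence "?K \<noteq> {}" by blast
  moreover have "continuous_on ?K (\<lambda>x. x \<bullet> (A *v x))"
    by (intro continuous_intros)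
  ultimately obtain e where e: "e \<in> ?K" and max: "\<And>y. y \<in> ?K \<Longrightarrow> y \<bullet> (A *v y) \<le> e \<bullet> (A *v e)"
    using continuous_attains_sup[of ?K "\<lambda>x. x \<bullet> (A *v x)"] by blast
  define l where "l = e \<bullet> (A *v e)"
  have e1: "e \<bullet> e = 1" "e \<in> S" using e by (auto simp: dot_square_norm)
  have le: "y \<bullet> (A *v y) \<le> l * (y \<bullet> y)" if "y \<in> S" for y
  proof (cases "y = 0")
    case False
    have "y /\<^sub>R norm y \<in> ?K" using False that S by (auto simp: subspace_scale)
    from max[OF this] have "(y \<bullet> (A *v y)) / (norm y)^2 \<le> l"
      by (simp add: l_def matrix_vector_mult_scaleR power2_eq_square divide_simps)
    thus ?thesis using False by (simp add: divide_simps dot_square_norm)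
  qed simp
  define w where "w = A *v e - l *\<^sub>R e"
  have wS: "w \<in> S" unfolding w_def using e1 inv S by (simp add: subspace_diff subspace_scale)
  have wAe: "A *v e = w + l *\<^sub>R e" by (simp add: w_def)
  have "(A *v e) \<bullet> e = l" unfolding l_def by (rule inner_commute)
  hence we: "w \<bullet> e = 0" by (simp add: w_def inner_diff_left e1)
  \<comment> \<open>This is the bound \<open>le\<close> at \<open>e + t w\<close>. By symmetry both
    cross terms equal \<open>w \<bullet> w\<close>, which gives the factor 2.\<close>
  have "2 * t * (w \<bullet> w) \<le> t^2 * (l * (w \<bullet> w) - w \<bullet> (A *v w))" for t
  proof -
    have "e + t *\<^sub>R w \<in> S" using e1 wS S by (simp add: subspace_add subspace_scale)
    from le[OF this] have "(e + t *\<^sub>R w) \<bullet> (A *v e + t *\<^sub>R (A *v w)) \<le> l * ((e + t *\<^sub>R w) \<bullet> (e + t *\<^sub>R w))"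
      by (simp add: matrix_vector_right_distrib matrix_vector_mult_scaleR)
    moreover have "e \<bullet> (A *v w) = w \<bullet> w"
      using symmetric_matrix_inner[OF sym, of e w] we wAe
      by (simp add: inner_add_left inner_add_right inner_commute)
    moreover have "e \<bullet> w = 0" using we by (simp add: inner_commute)
    ultimately show ?thesis using we e1
      by (simp add: wAe inner_add_left inner_add_right algebra_simps power2_eq_square)
  qed
  hence "w \<bullet> w = 0" by (intro linear_term_zero) auto
  hence "A *v e = l *\<^sub>R e" by (simp add: wAe)
  thus ?thesis using e by auto
qed

text \<open>Induction on the dimension: split off a unit eigenvector \<open>e\<close>. Symmetry
  makes the orthogonal complement of \<open>e\<close> in \<open>S\<close> invariant again.\<close>

lemma symmetric_matrix_eigenbasis_subspace:
  fixes A :: "real^'n^'n"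
  assumes sym: "transpose A = A" and "subspace S" and "\<And>x. x \<in> S \<Longrightarrow> A *v x \<in> S"
  shows "\<exists>B\<subseteq>S. pairwise orthogonal B \<and> (\<forall>x\<in>B. norm x = 1 \<and> (\<exists>l. A *v x = l *\<^sub>R x)) \<and> span B = S"
  using assms(2,3)
proof (induction "dim S" arbitrary: S rule: less_induct)
  case less
  show ?case
  proof (cases "S = {0}")
    case True
    thus ?thesis by (intro exI[of _ "{}"]) auto
  next
    case False
    then obtain e l where e: "e \<in> S" "norm e = 1" and l: "A *v e = l *\<^sub>R e"
      using symmetric_matrix_eigenvector_in_subspace[OF sym less.prems(1) False less.prems(2)] by blast
    define S' where "S' = {x\<in>S. e \<bullet> x = 0}"
    have ee: "e \<bullet> e = 1" using e by (simp add: dot_square_norm)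
    have S': "subspace S'"
      using less.prems(1) by (auto simp: S'_def subspace_def inner_add_right)
    have inv: "A *v x \<in> S'" if "x \<in> S'" for x
      using that less.prems(2) symmetric_matrix_inner[OF sym, of e x] l by (auto simp: S'_def)
    have "S' \<subset> S" using e ee by (force simp: S'_def)
    hence "dim S' < dim S" using S' less.prems(1)
      by (metis dim_psubset span_eq_iff)
    from less.hyps[OF this S' inv] obtain B where B: "B \<subseteq> S'" "pairwise orthogonal B"
      "\<forall>x\<in>B. norm x = 1 \<and> (\<exists>l. A *v x = l *\<^sub>R x)" "span B = S'" by blast
    have "span (insert e B) = S"
    proof
      show "span (insert e B) \<subseteq> S"
        using B(1) e by (intro span_minimal less.prems(1)) (auto simp: S'_def)
      show "S \<subseteq> span (insert e B)"
      proof
        fix x assume x: "x \<in> S"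
        have "x - (e \<bullet> x) *\<^sub>R e \<in> S'"
          using x e ee less.prems(1) by (simp add: S'_def subspace_diff subspace_scale inner_diff_right)
        thus "x \<in> span (insert e B)" unfolding B(4)[symmetric] by (auto simp: span_insert)
      qed
    qed
    moreover have "pairwise orthogonal (insert e B)"
      using B(1,2) by (auto simp: pairwise_insert orthogonal_def S'_def inner_commute)
    moreover have "insert e B \<subseteq> S" using B(1) e by (auto simp: S'_def)
    ultimately show ?thesis using B(3) e l by (intro exI[of _ "insert e B"]) auto
  qed
qed

text \<open>Indexing by the coordinate type \<open>'n\<close> itself makes every such family a
  basis, by counting dimensions.\<close>

definition orthonormal_family :: "('n \<Rightarrow> real^'n) \<Rightarrow> bool" where
  "orthonormal_family b \<longleftrightarrow> (\<forall>i j. b i \<bullet> b j = (if i = j then 1 else 0))"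

lemma orthonormal_family_inner:
  "orthonormal_family b \<Longrightarrow> b i \<bullet> b j = (if i = j then 1 else 0)"
  by (simp add: orthonormal_family_def)

lemma symmetric_matrix_eigenbasis:
  fixes A :: "real^'n^'n"
  assumes "transpose A = A"
  obtains b l where "orthonormal_family b" and "\<And>i. A *v b i = l i *\<^sub>R b i"
proof -
  obtain B where B: "pairwise orthogonal B" "\<forall>x\<in>B. norm x = 1 \<and> (\<exists>l. A *v x = l *\<^sub>R x)" "span B = UNIV"
    using symmetric_matrix_eigenbasis_subspace[OF assms subspace_UNIV] by auto
  have "independent B" using B by (intro pairwise_orthogonal_independent) auto
  hence "finite B" "card B = CARD('n)"
    using B(3) dim_span_eq_card_independent[of B] by (auto simp: independent_imp_finite)
  then obtain b where b: "bij_betw b (UNIV :: 'n set) B"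
    using finite_same_card_bij[of "UNIV :: 'n set" B] by auto
  have bB: "b i \<in> B" for i using b by (auto simp: bij_betw_def)
  have "\<forall>i. \<exists>r. A *v b i = r *\<^sub>R b i" using B(2) bB by blast
  from choice[OF this] obtain l where "\<And>i. A *v b i = l i *\<^sub>R b i" by blast
  moreover have "orthonormal_family b"
  proof -
    have "b i \<bullet> b j = 0" if "i \<noteq> j" for i j
    proof -
      have "b i \<noteq> b j" using that b by (auto simp: bij_betw_def inj_def)
      thus ?thesis using B(1) bB by (simp add: pairwise_def orthogonal_def)
    qed
    moreover have "b i \<bullet> b i = 1" for i using B(2) bB by (simp add: dot_square_norm)
    ultimately show ?thesis by (auto simp: orthonormal_family_def)
  qed
  ultimately show ?thesis using that by blast
qed

text \<open>The remainder \<open>w\<close> is orthogonal to every \<open>b j\<close>, hence to their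
  span. That span is the whole space, so \<open>w\<close> is orthogonal to itself.\<close>

lemma orthonormal_expansion:
  fixes b :: "'n \<Rightarrow> real^'n"
  assumes b: "orthonormal_family b"
  shows "(\<Sum>i\<in>UNIV. (x \<bullet> b i) *\<^sub>R b i) = x"
proof -
  have inj: "inj b"
  proof (rule injI)
    fix i j assume "b i = b j"
    hence "b i \<bullet> b j = 1" using b by (simp add: orthonormal_family_def)
    thus "i = j" using b by (auto simp: orthonormal_family_def split: if_splits)
  qed
  have "independent (range b)"
    using b inj by (intro pairwise_orthogonal_independent)
      (auto simp: pairwise_def orthogonal_def orthonormal_family_def, metis inner_zero_left zero_neq_one)
  moreover have "card (range b) = CARD('n)" using inj by (simp add: card_image)
  ultimately have sp: "span (range b) = UNIV"
    using card_ge_dim_independent[of "range b" UNIV] by auto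
  define w where "w = x - (\<Sum>i\<in>UNIV. (x \<bullet> b i) *\<^sub>R b i)"
  have "orthogonal w (b j)" for j
    by (simp add: w_def orthogonal_def inner_diff_left inner_sum_left orthonormal_family_inner[OF b]
        if_distrib cong: if_cong)
  hence "orthogonal w w"
    by (intro orthogonal_to_span[of w "range b"]) (auto simp: sp)
  thus ?thesis by (simp add: w_def orthogonal_def)
qed

lemma orthonormal_inner:
  fixes b :: "'n \<Rightarrow> real^'n"
  assumes b: "orthonormal_family b"
  shows "x \<bullet> y = (\<Sum>i\<in>UNIV. (x \<bullet> b i) * (y \<bullet> b i))"
proof -
  have "x \<bullet> y = (\<Sum>i\<in>UNIV. (x \<bullet> b i) *\<^sub>R b i) \<bullet> y"
    by (simp only: orthonormal_expansion[OF b])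
  also have "\<dots> = (\<Sum>i\<in>UNIV. (x \<bullet> b i) * (b i \<bullet> y))"
    by (simp add: inner_sum_left)
  also have "\<dots> = (\<Sum>i\<in>UNIV. (x \<bullet> b i) * (y \<bullet> b i))"
    by (simp add: inner_commute)
  finally show ?thesis .
qed

lemma orthonormal_eqI:
  fixes b :: "'n \<Rightarrow> real^'n"
  assumes "orthonormal_family b" and "\<And>i. x \<bullet> b i = y \<bullet> b i"
  shows "x = y"
proof -
  have "x = (\<Sum>i\<in>UNIV. (x \<bullet> b i) *\<^sub>R b i)" by (rule orthonormal_expansion[OF assms(1), symmetric])
  also have "\<dots> = y" unfolding assms(2) by (rule orthonormal_expansion[OF assms(1)])
  finally show ?thesis .
qed

section \<open>Functional calculus: matrices diagonal in a fixed orthonormal basis, as sums of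
  rank-one projectors\<close>

definition spectral_matrix :: "('n \<Rightarrow> real^'n) \<Rightarrow> ('n \<Rightarrow> real) \<Rightarrow> real^'n^'n" where
  "spectral_matrix b f = (\<Sum>a\<in>UNIV. f a *\<^sub>R (\<chi> i j. b a $ i * b a $ j))"

lemma spectral_matrix_mult_vec:
  "spectral_matrix b f *v x = (\<Sum>a\<in>UNIV. (f a * (x \<bullet> b a)) *\<^sub>R b a)"
proof -
  have "(\<chi> i j. b a $ i * b a $ j) *v x = (x \<bullet> b a) *\<^sub>R b a" for a
    by (simp add: vec_eq_iff matrix_vector_mult_def inner_vec_def sum_distrib_left
        sum_distrib_right mult_ac)
  moreover have "(\<Sum>a\<in>S. f a *\<^sub>R (\<chi> i j. b a $ i * b a $ j)) *v x
      = (\<Sum>a\<in>S. (f a *\<^sub>R (\<chi> i j. b a $ i * b a $ j)) *v x)" if "finite S" for S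
    using that by induction (auto simp: matrix_vector_mult_add_rdistrib)
  ultimately show ?thesis
    by (simp add: spectral_matrix_def scaleR_matrix_vector_assoc[symmetric])
qed

lemma spectral_matrix_eigen:
  assumes "orthonormal_family b"
  shows "spectral_matrix b f *v b i = f i *\<^sub>R b i"
  by (simp add: spectral_matrix_mult_vec orthonormal_family_inner[OF assms] if_distrib if_distribR
    cong: if_cong)

text \<open>A matrix is determined by its action on the basis. This turns \<open>A\<close>,
  products, the identity and square roots into operations on the eigenvalues.\<close>

lemma spectral_matrixI:
  assumes b: "orthonormal_family b" and "\<And>i. X *v b i = f i *\<^sub>R b i"
  shows "X = spectral_matrix b f"
proof (subst matrix_eq, intro allI)
  fix x
  have "X *v (\<Sum>i\<in>UNIV. (x \<bullet> b i) *\<^sub>R b i) = (\<Sum>i\<in>UNIV. (x \<bullet> b i) *\<^sub>R (X *v b i))"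
    by (simp add: linear_sum[OF matrix_vector_mul_linear] matrix_vector_mult_scaleR)
  also have "\<dots> = spectral_matrix b f *v x"
    by (simp add: assms(2) spectral_matrix_mult_vec mult.commute)
  finally show "X *v x = spectral_matrix b f *v x" by (simp only: orthonormal_expansion[OF b])
qed

lemma spectral_matrix_inner:
  assumes b: "orthonormal_family b"
  shows "(spectral_matrix b f *v x) \<bullet> b i = f i * (x \<bullet> b i)"
  by (simp add: spectral_matrix_mult_vec inner_sum_left orthonormal_family_inner[OF b] if_distrib
    cong: if_cong)

lemma spectral_matrix_mult:
  assumes b: "orthonormal_family b"
  shows "spectral_matrix b f ** spectral_matrix b g = spectral_matrix b (\<lambda>i. f i * g i)"
  by (rule spectral_matrixI[OF b])
    (simp add: matrix_vector_mul_assoc[symmetric] spectral_matrix_eigen[OF b]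
      matrix_vector_mult_scaleR mult.commute)

lemma spectral_matrix_one:
  assumes b: "orthonormal_family b"
  shows "spectral_matrix b (\<lambda>_. 1) = mat 1"
  by (rule spectral_matrixI[OF b, symmetric]) simp

lemma spectral_matrix_funpow:
  assumes b: "orthonormal_family b"
  shows "(((**) (spectral_matrix b f)) ^^ n) (mat 1) = spectral_matrix b (\<lambda>i. f i ^ n)"
  by (induction n) (simp_all add: spectral_matrix_one[OF b] spectral_matrix_mult[OF b])

lemma matrix_inv_eqI:
  fixes A B :: "real^'n^'n"
  assumes "A ** B = mat 1" "B ** A = mat 1"
  shows "matrix_inv A = B"
proof -
  have "A ** matrix_inv A = mat 1 \<and> matrix_inv A ** A = mat 1"
    unfolding matrix_inv_def by (rule someI[of _ B]) (use assms in simp)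
  thus ?thesis using assms by (metis matrix_mul_assoc matrix_mul_lid matrix_mul_rid)
qed

lemma matrix_inv_spectral_matrix:
  assumes b: "orthonormal_family b" and "\<And>i. f i \<noteq> 0"
  shows "matrix_inv (spectral_matrix b f) = spectral_matrix b (\<lambda>i. inverse (f i))"
  by (rule matrix_inv_eqI) (simp_all add: spectral_matrix_mult[OF b] assms(2) spectral_matrix_one[OF b])

lemma matrix_power_int_spectral_matrix:
  assumes b: "orthonormal_family b" and "\<And>i. f i \<noteq> 0"
  shows "matrix_power_int (spectral_matrix b f) k = spectral_matrix b (\<lambda>i. f i powi k)"
  unfolding matrix_power_int_def power_int_def
  by (auto simp: spectral_matrix_funpow[OF b] matrix_inv_spectral_matrix[OF b assms(2)])

text \<open>In the eigenbasis the matrix series is a finite combination of scalar Laurent series,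
  one per eigenvalue, so it converges along with them.\<close>

lemma laurent_matrix_spectral_matrix:
  assumes b: "orthonormal_family b" and nz: "\<And>i. f i \<noteq> 0"
    and s: "\<And>i. laurent_sums (\<lambda>k. c k * f i powi k) (s i)"
  shows "laurent_matrix c (spectral_matrix b f) = spectral_matrix b s"
proof -
  obtain s1 s2 where s1: "\<And>i. (\<lambda>n. c (int n) * f i powi int n) sums s1 i"
    and s2: "\<And>i. (\<lambda>n. c (- int (Suc n)) * f i powi (- int (Suc n))) sums s2 i"
    and s12: "\<And>i. s i = s1 i + s2 i"
  proof -
    have "\<forall>i. \<exists>t. (\<lambda>n. c (int n) * f i powi int n) sums fst t \<and>
        (\<lambda>n. c (- int (Suc n)) * f i powi (- int (Suc n))) sums snd t \<and> s i = fst t + snd t"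
      using s unfolding laurent_sums_def by (auto simp del: of_nat_Suc)
    from choice[OF this] obtain t where "\<And>i. (\<lambda>n. c (int n) * f i powi int n) sums fst (t i) \<and>
        (\<lambda>n. c (- int (Suc n)) * f i powi (- int (Suc n))) sums snd (t i) \<and> s i = fst (t i) + snd (t i)"
      by blast
    thus ?thesis by (intro that[of "\<lambda>i. fst (t i)" "\<lambda>i. snd (t i)"]) auto
  qed
  have eq: "c k *\<^sub>R spectral_matrix b (\<lambda>i. f i powi k) = (\<Sum>a\<in>UNIV. (c k * f a powi k) *\<^sub>R (\<chi> i j. b a $ i * b a $ j))" for k
    by (simp add: spectral_matrix_def scaleR_sum_right)
  have "laurent_sums (\<lambda>k. c k *\<^sub>R matrix_power_int (spectral_matrix b f) k) (spectral_matrix b s)"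
    unfolding laurent_sums_def matrix_power_int_spectral_matrix[OF b nz] eq
  proof (intro exI conjI)
    show "(\<lambda>n. \<Sum>a\<in>UNIV. (c (int n) * f a powi int n) *\<^sub>R (\<chi> i j. b a $ i * b a $ j)) sums spectral_matrix b s1"
      unfolding spectral_matrix_def by (intro sums_sum sums_scaleR_left s1)
    show "(\<lambda>n. \<Sum>a\<in>UNIV. (c (- int (Suc n)) * f a powi (- int (Suc n))) *\<^sub>R (\<chi> i j. b a $ i * b a $ j)) sums spectral_matrix b s2"
      unfolding spectral_matrix_def by (intro sums_sum sums_scaleR_left s2)
    show "spectral_matrix b s = spectral_matrix b s1 + spectral_matrix b s2"
      by (simp add: spectral_matrix_def s12 scaleR_add_left sum.distrib)
  qed
  thus ?thesis unfolding laurent_matrix_def by (rule laurent_sums_unique)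
qed

lemma pos_sqrt_matrix_spectral_matrix:
  assumes b: "orthonormal_family b" and pos: "\<And>i. f i > 0"
  shows "pos_sqrt_matrix (spectral_matrix b f) = spectral_matrix b (\<lambda>i. sqrt (f i))"
  unfolding pos_sqrt_matrix_def
proof (rule the_equality, intro conjI)
  have "transpose (spectral_matrix b (\<lambda>i. sqrt (f i))) = spectral_matrix b (\<lambda>i. sqrt (f i))"
    by (simp add: vec_eq_iff transpose_def spectral_matrix_def mult_ac)
  moreover have "(spectral_matrix b (\<lambda>i. sqrt (f i)) *v v) \<bullet> v \<ge> 0" for v
    unfolding orthonormal_inner[OF b, of _ v] spectral_matrix_inner[OF b]
    by (intro sum_nonneg) (simp add: mult.assoc less_imp_le[OF pos])
  ultimately show "pos_semidef_matrix (spectral_matrix b (\<lambda>i. sqrt (f i)))"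
    by (simp add: pos_semidef_matrix_def)
  show "spectral_matrix b (\<lambda>i. sqrt (f i)) ** spectral_matrix b (\<lambda>i. sqrt (f i)) = spectral_matrix b f"
    by (simp add: spectral_matrix_mult[OF b] less_imp_le[OF pos])
next
  fix B assume B: "pos_semidef_matrix B \<and> B ** B = spectral_matrix b f"
  show "B = spectral_matrix b (\<lambda>i. sqrt (f i))"
  proof (rule spectral_matrixI[OF b])
    fix i
    define r where "r = sqrt (f i)"
    have r: "r > 0" "r * r = f i" using pos[of i] by (simp_all add: r_def)
    \<comment> \<open>Uniqueness of the root: \<open>(B + r) (B - r)\<close> annihilates
      \<open>b i\<close>, so \<open>w\<close> satisfies \<open>B w = - r w\<close>. Since
      \<open>B\<close> is semidefinite and \<open>r > 0\<close>, \<open>w\<close> vanishes.\<close>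
    define w where "w = B *v b i - r *\<^sub>R b i"
    have "B *v (B *v b i) = f i *\<^sub>R b i"
      using B by (simp add: matrix_vector_mul_assoc spectral_matrix_eigen[OF b])
    hence "B *v w = - r *\<^sub>R w"
      by (simp add: w_def matrix_vector_mult_diff_distrib matrix_vector_mult_scaleR r(2)[symmetric] algebra_simps)
    hence "- r * (w \<bullet> w) \<ge> 0" using B by (metis inner_scaleR_left pos_semidef_matrix_def)
    hence "w \<bullet> w \<le> 0" using r(1) by (simp only: mult_minus_left neg_0_le_iff_le mult_le_0_iff) auto
    hence "w = 0" using inner_ge_zero[of w] by (metis antisym inner_eq_zero_iff)
    thus "B *v b i = sqrt (f i) *\<^sub>R b i" by (simp add: w_def r_def)
  qed
qed

section \<open>Nonzero projections onto eigenspaces, read off from coordinates\<close>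

lemma orth_projector_nonzeroD:
  assumes "orth_projector S x \<noteq> 0" and "subspace S"
  shows "\<exists>s\<in>S. x \<bullet> s \<noteq> 0"
proof (rule ccontr)
  assume "\<not> ?thesis"
  hence *: "x \<bullet> s = 0" if "s \<in> S" for s using that by blast
  have "orth_projector S x = 0"
    unfolding orth_projector_def
  proof (rule the_equality)
    show "0 \<in> S \<and> (\<forall>s\<in>S. orthogonal (x - 0) s)"
      using * assms(2) by (simp add: orthogonal_def subspace_0)
    fix w assume w: "w \<in> S \<and> (\<forall>s\<in>S. orthogonal (x - w) s)"
    hence "(x - w) \<bullet> w = 0" "x \<bullet> w = 0" using * by (auto simp: orthogonal_def)
    thus "w = 0" by (simp add: inner_diff_left)
  qed
  thus False using assms(1) by simp
qed

text \<open>Some term of the coordinate sum for \<open>x \<bullet> s\<close> is nonzero, and an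
  eigenvector for \<open>r\<close> has nonzero coordinates only at indices with
  \<open>l i = r\<close>.\<close>

lemma eigenspace_orthonormal:
  assumes b: "orthonormal_family b" and A: "A = spectral_matrix b l" and s: "s \<in> eigenspace A r"
    and ne: "x \<bullet> s \<noteq> 0"
  shows "\<exists>i. l i = r \<and> x \<bullet> b i \<noteq> 0"
proof -
  have "(\<Sum>i\<in>UNIV. (x \<bullet> b i) * (s \<bullet> b i)) \<noteq> 0" using ne orthonormal_inner[OF b] by metis
  then obtain i where i: "x \<bullet> b i \<noteq> 0" "s \<bullet> b i \<noteq> 0"
    by (metis (no_types, lifting) mult_eq_0_iff sum.neutral)
  have "(r *\<^sub>R s) \<bullet> b i = l i * (s \<bullet> b i)"
    using s spectral_matrix_inner[OF b, of l s i] by (simp only: eigenspace_def A mem_Collect_eq)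
  hence "l i = r" using i by simp
  thus ?thesis using i by blast
qed

section \<open>Dynamics of the spectral weights\<close>

text \<open>Around each \<open>c\<close> outside \<open>F\<close> lies a gap that the sequence
  eventually avoids and, with vanishing increments, cannot jump. So it stays on one side of
  \<open>c\<close>. As \<open>F\<close> is finite, such \<open>c\<close> exist arbitrarily close to
  a subsequential limit \<open>L\<close> on both sides and trap the sequence there.\<close>

lemma convergent_if_finitely_many_limit_points:
  fixes a :: "nat \<Rightarrow> real"
  assumes bdd: "bounded (range a)" and incr: "(\<lambda>k. a (Suc k) - a k) \<longlonglongrightarrow> 0" and F: "finite F"
    and away: "\<And>c. c \<notin> F \<Longrightarrow> \<exists>e>0. \<forall>\<^sub>F k in sequentially. e \<le> \<bar>a k - c\<bar>"
  shows "convergent a"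
proof -
  have side: "(\<forall>\<^sub>F k in sequentially. a k < c) \<or> (\<forall>\<^sub>F k in sequentially. c < a k)" if c: "c \<notin> F" for c
  proof -
    obtain e where e: "e > 0" "\<forall>\<^sub>F k in sequentially. e \<le> \<bar>a k - c\<bar>" using away[OF c] by blast
    have "\<forall>\<^sub>F k in sequentially. \<bar>a (Suc k) - a k\<bar> < e"
      using tendstoD[OF incr e(1)] by (simp add: dist_real_def)
    with e(2) have "\<forall>\<^sub>F k in sequentially. e \<le> \<bar>a k - c\<bar> \<and> \<bar>a (Suc k) - a k\<bar> < e"
      by eventually_elim auto
    then obtain N where N: "\<And>k. k \<ge> N \<Longrightarrow> e \<le> \<bar>a k - c\<bar> \<and> \<bar>a (Suc k) - a k\<bar> < e"
      by (auto simp: eventually_sequentially)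
    show ?thesis
    proof (cases "a N < c")
      case True
      have "a k < c" if "k \<ge> N" for k
        using that
      proof (induction k rule: dec_induct)
        case (step k)
        thus ?case using N[of k] N[of "Suc k"] by auto
      qed (rule True)
      thus ?thesis by (auto simp: eventually_sequentially)
    next
      case False
      have "a k > c" if "k \<ge> N" for k
        using that
      proof (induction k rule: dec_induct)
        case base
        show ?case using False N[of N] e(1) by auto
      next
        case (step k)
        thus ?case using N[of k] N[of "Suc k"] by auto
      qed
      thus ?thesis by (auto simp: eventually_sequentially)
    qed
  qed
  obtain L r where r: "strict_mono r" and L: "(a \<circ> r) \<longlonglongrightarrow> L"
    using bounded_imp_convergent_subsequence[OF bdd] by blast
  have pick: "\<exists>c. x < c \<and> c < y \<and> c \<notin> F" if "x < y" for x y :: real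
  proof -
    have "infinite ({x<..<y} - F)" using F that by (intro Diff_infinite_finite infinite_Ioo)
    then obtain c where "c \<in> {x<..<y} - F" by (metis finite.emptyI ex_in_conv)
    thus ?thesis by auto
  qed
  have sub: "\<forall>\<^sub>F k in sequentially. Q (a (r k))" if "\<forall>\<^sub>F k in sequentially. Q (a k)" for Q
    using eventually_subseq[OF r that] by simp
  have not_both: False if "\<forall>\<^sub>F k in sequentially. b k < c" "\<forall>\<^sub>F k in sequentially. c < b k"
    for b :: "nat \<Rightarrow> real" and c
    using eventually_happens[OF eventually_conj[OF that]] by auto
  have "a \<longlonglongrightarrow> L"
  proof (rule order_tendstoI)
    fix x assume "x < L"
    then obtain c where c: "x < c" "c < L" "c \<notin> F" using pick by blast
    have "\<forall>\<^sub>F k in sequentially. c < a (r k)"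
      using order_tendstoD(1)[OF L c(2)] by simp
    hence "\<not> (\<forall>\<^sub>F k in sequentially. a k < c)"
      using sub[of "\<lambda>x. x < c"] not_both[of "\<lambda>k. a (r k)" c] by blast
    hence "\<forall>\<^sub>F k in sequentially. c < a k" using side[OF c(3)] by blast
    thus "\<forall>\<^sub>F k in sequentially. x < a k" by eventually_elim (use c in simp)
  next
    fix x assume "L < x"
    then obtain c where c: "L < c" "c < x" "c \<notin> F" using pick by blast
    have "\<forall>\<^sub>F k in sequentially. a (r k) < c"
      using order_tendstoD(2)[OF L c(1)] by simp
    hence "\<not> (\<forall>\<^sub>F k in sequentially. c < a k)"
      using sub[of "\<lambda>x. c < x"] not_both[of "\<lambda>k. a (r k)" c] by blast
    hence "\<forall>\<^sub>F k in sequentially. a k < c" using side[OF c(3)] by blast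
    thus "\<forall>\<^sub>F k in sequentially. a k < x" by eventually_elim (use c in simp)
  qed
  thus ?thesis by (rule convergentI)
qed

section \<open>Probability weights on the spectrum and their one-step evolution\<close>

definition weight_mean :: "('i \<Rightarrow> real) \<Rightarrow> real^'i \<Rightarrow> real" where
  "weight_mean l w = (\<Sum>i\<in>UNIV. l i * w $ i)"

definition weight_var :: "('i \<Rightarrow> real) \<Rightarrow> real^'i \<Rightarrow> real" where
  "weight_var l w = (\<Sum>i\<in>UNIV. (l i - weight_mean l w)^2 * w $ i)"

text \<open>Eigenvalues may be multiple, so the mass at \<open>r\<close> collects all indices
  carrying it.\<close>

definition weight_at :: "('i \<Rightarrow> real) \<Rightarrow> real \<Rightarrow> real^'i \<Rightarrow> real" where
  "weight_at l r w = (\<Sum>i | l i = r. w $ i)"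

text \<open>The algorithm as seen by the squared eigenbasis coordinates of the renormalised
  gradients. The polynomial weight \<open>P\<close> has cancelled from the recursion.\<close>

locale weight_iteration =
  fixes l :: "'i::finite \<Rightarrow> real" and m M :: real and w :: "nat \<Rightarrow> real^'i"
  assumes l_bounds: "\<And>i. m \<le> l i" "\<And>i. l i \<le> M"
    and m_less_M: "m < M"
    and w0_nonneg: "\<And>i. 0 \<le> w 0 $ i"
    and w0_sum: "(\<Sum>i\<in>UNIV. w 0 $ i) = 1"
    and w_Suc: "\<And>k i. w (Suc k) $ i = (l i - weight_mean l (w k))^2 / weight_var l (w k) * w k $ i"
    and w0_m: "\<exists>i. l i = m \<and> w 0 $ i > 0"
    and w0_M: "\<exists>i. l i = M \<and> w 0 $ i > 0"
begin

abbreviation "\<mu> k \<equiv> weight_mean l (w k)"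
abbreviation "V k \<equiv> weight_var l (w k)"

definition "im = (SOME i. l i = m \<and> w 0 $ i > 0)"
definition "iM = (SOME i. l i = M \<and> w 0 $ i > 0)"

lemma im: "l im = m" "w 0 $ im > 0" and iM: "l iM = M" "w 0 $ iM > 0"
  using someI_ex[OF w0_m] someI_ex[OF w0_M] by (auto simp: im_def iM_def)

lemma mean_bounds_var_pos:
  assumes nonneg: "\<And>i. 0 \<le> x $ i" and sum: "(\<Sum>i\<in>UNIV. x $ i) = 1"
    and pos: "x $ im > 0" "x $ iM > 0"
  shows "m < weight_mean l x" "weight_mean l x < M" "weight_var l x > 0"
proof -
  have "(\<Sum>i\<in>UNIV. (l i - m) * x $ i) > 0"
    by (rule sum_pos2[of _ iM]) (use l_bounds nonneg pos iM m_less_M in auto)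
  thus "m < weight_mean l x"
    by (simp add: weight_mean_def left_diff_distrib sum_subtractf sum_distrib_left[symmetric] sum)
  have "(\<Sum>i\<in>UNIV. (M - l i) * x $ i) > 0"
    by (rule sum_pos2[of _ im]) (use l_bounds nonneg pos im m_less_M in auto)
  thus less: "weight_mean l x < M"
    by (simp add: weight_mean_def left_diff_distrib sum_subtractf sum_distrib_left[symmetric] sum)
  show "weight_var l x > 0"
    unfolding weight_var_def by (rule sum_pos2[of _ iM]) (use nonneg pos iM less in auto)
qed

text \<open>The divisor \<open>V k\<close> is exactly the new total mass, so the sum stays 1. The
  mean lies strictly between \<open>m\<close> and \<open>M\<close>, so the factors at both ends are
  nonzero.\<close>

lemma invariant:
  "(\<forall>i. 0 \<le> w k $ i) \<and> (\<Sum>i\<in>UNIV. w k $ i) = 1 \<and> w k $ im > 0 \<and> w k $ iM > 0"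
proof (induction k)
  case 0
  thus ?case using w0_nonneg w0_sum im iM by auto
next
  case (Suc k)
  note f = mean_bounds_var_pos[of "w k"]
  have V: "V k > 0" and mu: "m < \<mu> k" "\<mu> k < M" using Suc f by auto
  have "(\<Sum>i\<in>UNIV. w (Suc k) $ i) = V k / V k"
    unfolding w_Suc weight_var_def sum_divide_distrib by simp
  thus ?case using Suc V mu im iM by (auto simp: w_Suc zero_less_mult_iff zero_less_divide_iff)
qed

lemma w_nonneg: "0 \<le> w k $ i" and w_sum: "(\<Sum>i\<in>UNIV. w k $ i) = 1"
  and w_im_pos: "w k $ im > 0" and w_iM_pos: "w k $ iM > 0"
  using invariant by auto

lemma mu_bounds: "m < \<mu> k" "\<mu> k < M" and V_pos: "V k > 0"
  using mean_bounds_var_pos[of "w k"] invariant by auto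

lemma w_le_1: "w k $ i \<le> 1"
  using member_le_sum[of i UNIV "\<lambda>i. w k $ i"] w_sum[of k] w_nonneg by auto

text \<open>By \<open>mu_Suc\<close> this is the monic quadratic orthogonal polynomial of the
  distribution \<open>w k\<close>. It also measures how far two consecutive steps are from
  cancelling, see \<open>w_Suc_Suc\<close>.\<close>

definition h :: "nat \<Rightarrow> real \<Rightarrow> real" where
  "h k t = (t - \<mu> k) * (t - \<mu> (Suc k)) - V k"

lemma first_moment: "(\<Sum>i\<in>UNIV. (l i - \<mu> k) * w k $ i) = 0"
proof -
  have "(\<Sum>i\<in>UNIV. (l i - \<mu> k) * w k $ i) = \<mu> k - \<mu> k * (\<Sum>i\<in>UNIV. w k $ i)"
    unfolding sum_distrib_left by (simp add: weight_mean_def left_diff_distrib sum_subtractf)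
  thus ?thesis by (simp add: w_sum)
qed

lemma mu_Suc: "\<mu> (Suc k) = \<mu> k + (\<Sum>i\<in>UNIV. (l i - \<mu> k)^3 * w k $ i) / V k"
proof -
  have "\<mu> (Suc k) * V k = (\<Sum>i\<in>UNIV. l i * (l i - \<mu> k)^2 * w k $ i)"
    using V_pos[of k] by (simp add: weight_mean_def[of l "w (Suc k)"] w_Suc sum_distrib_right mult.assoc)
  also have "\<dots> = (\<Sum>i\<in>UNIV. (l i - \<mu> k)^3 * w k $ i + \<mu> k * ((l i - \<mu> k)^2 * w k $ i))"
    by (intro sum.cong) (auto simp: algebra_simps power2_eq_square power3_eq_cube)
  also have "\<dots> = (\<Sum>i\<in>UNIV. (l i - \<mu> k)^3 * w k $ i) + \<mu> k * V k"
    by (simp only: sum.distrib sum_distrib_left[symmetric] weight_var_def)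
  finally show ?thesis using V_pos[of k] by (simp add: field_simps)
qed

text \<open>This identity makes \<open>V\<close> a Lyapunov function.\<close>

lemma h_identity: "(\<Sum>i\<in>UNIV. w k $ i * (h k (l i))^2) = V k * (V (Suc k) - V k)"
proof -
  \<comment> \<open>Both sides reduce to central moments. Since \<open>a 3 = d * V k\<close>, only
    \<open>a 4\<close>, \<open>d\<close> and \<open>V k\<close> remain.\<close>
  define a where "a n = (\<Sum>i\<in>UNIV. (l i - \<mu> k)^n * w k $ i)" for n
  define d where "d = \<mu> (Suc k) - \<mu> k"
  have a0: "a 0 = 1" "a 1 = 0" "a 2 = V k"
    by (simp_all add: a_def w_sum first_moment) (simp add: weight_var_def)
  have a3: "a 3 = d * V k" using V_pos[of k] by (simp add: d_def mu_Suc a_def)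
  have "V (Suc k) * V k = (\<Sum>i\<in>UNIV. ((l i - \<mu> k) - d)^2 * (l i - \<mu> k)^2 * w k $ i)"
    using V_pos[of k] by (simp add: weight_var_def[of l "w (Suc k)"] w_Suc sum_distrib_right d_def mult.assoc)
  also have "\<dots> = (\<Sum>i\<in>UNIV. (l i - \<mu> k)^4 * w k $ i - 2 * d * ((l i - \<mu> k)^3 * w k $ i) + d^2 * ((l i - \<mu> k)^2 * w k $ i))"
    by (intro sum.cong) (auto simp: algebra_simps power2_eq_square power3_eq_cube power4_eq_xxxx)
  also have "\<dots> = a 4 - 2 * d * a 3 + d^2 * a 2"
    by (simp only: sum.distrib sum_subtractf sum_distrib_left[symmetric] a_def)
  finally have VV: "V (Suc k) * V k = a 4 - d^2 * V k" by (simp add: a3 a0 power2_eq_square)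
  have "(\<Sum>i\<in>UNIV. w k $ i * (h k (l i))^2) = (\<Sum>i\<in>UNIV. w k $ i * ((l i - \<mu> k)^2 - d * (l i - \<mu> k) - V k)^2)"
    by (intro sum.cong) (auto simp: h_def d_def algebra_simps power2_eq_square)
  \<comment> \<open>The exponents 1 and 0 are kept so that every summand has the shape of a moment
    \<open>a n\<close>.\<close>
  also have "\<dots> = (\<Sum>i\<in>UNIV. (l i - \<mu> k)^4 * w k $ i - 2 * d * ((l i - \<mu> k)^3 * w k $ i) + (d^2 - 2 * V k) * ((l i - \<mu> k)^2 * w k $ i)
      + 2 * d * V k * ((l i - \<mu> k)^1 * w k $ i) + (V k)^2 * ((l i - \<mu> k)^0 * w k $ i))"
    by (intro sum.cong) (auto simp: algebra_simps power2_eq_square power3_eq_cube power4_eq_xxxx)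
  also have "\<dots> = a 4 - 2 * d * a 3 + (d^2 - 2 * V k) * a 2 + 2 * d * V k * a 1 + (V k)^2 * a 0"
    by (simp only: sum.distrib sum_subtractf sum_distrib_left[symmetric] a_def)
  also have "\<dots> = V k * (V (Suc k) - V k)"
    using VV by (simp add: a3 a0(1,3) a0(2)[unfolded One_nat_def] power2_eq_square algebra_simps)
  finally show ?thesis .
qed

lemma V_Suc_ge: "V k \<le> V (Suc k)"
proof -
  have "0 \<le> V k * (V (Suc k) - V k)"
    unfolding h_identity[symmetric] by (intro sum_nonneg mult_nonneg_nonneg w_nonneg) auto
  thus ?thesis using V_pos[of k] by (simp add: zero_le_mult_iff)
qed

lemma V_le: "V k \<le> (M - m)^2"
proof -
  have "(l i - \<mu> k)^2 \<le> (M - m)^2" for i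
    using l_bounds[of i] mu_bounds[of k] by (intro power2_le_iff_abs_le[THEN iffD2]) auto
  hence "V k \<le> (\<Sum>i\<in>UNIV. (M - m)^2 * w k $ i)"
    unfolding weight_var_def by (intro sum_mono mult_right_mono w_nonneg) auto
  also have "\<dots> = (M - m)^2" by (simp add: sum_distrib_left[symmetric] w_sum)
  finally show ?thesis .
qed

section \<open>Convergence of the variance and asymptotic two-periodicity\<close>

definition "Vlim = lim V"

lemma V_tendsto: "V \<longlonglongrightarrow> Vlim" and Vlim_pos: "Vlim > 0"
proof -
  have inc: "incseq V" using V_Suc_ge by (rule incseq_SucI)
  have "convergent V"
    by (rule Bseq_mono_convergent[OF _ ]) (use inc V_le V_pos in \<open>auto intro!: BseqI'[of _ "(M - m)^2"] simp: incseq_def less_imp_le\<close>)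
  thus *: "V \<longlonglongrightarrow> Vlim" by (simp add: Vlim_def convergent_LIMSEQ_iff)
  have "V 0 \<le> Vlim" using inc * by (rule incseq_le)
  thus "Vlim > 0" using V_pos[of 0] by simp
qed

text \<open>Each term is nonnegative and bounded by the sum in \<open>h_identity\<close>, which
  tends to 0 because \<open>V\<close> converges.\<close>

lemma w_h_tendsto: "(\<lambda>k. w k $ i * (h k (l i))^2) \<longlonglongrightarrow> 0"
proof (rule tendsto_sandwich)
  show "\<forall>\<^sub>F k in sequentially. 0 \<le> w k $ i * (h k (l i))^2"
    by (simp add: w_nonneg)
  show "\<forall>\<^sub>F k in sequentially. w k $ i * (h k (l i))^2 \<le> V k * (V (Suc k) - V k)"
    unfolding h_identity[symmetric]
    by (intro always_eventually allI member_le_sum[of i]) (auto simp: w_nonneg)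
  have "(\<lambda>k. V k * (V (Suc k) - V k)) \<longlonglongrightarrow> Vlim * (Vlim - Vlim)"
    by (intro tendsto_intros V_tendsto LIMSEQ_Suc)
  thus "(\<lambda>k. V k * (V (Suc k) - V k)) \<longlonglongrightarrow> 0" by simp
qed simp

lemma w_Suc_Suc: "w (Suc (Suc k)) $ i = w k $ i * (h k (l i) + V k)^2 / (V k * V (Suc k))"
  by (simp add: w_Suc h_def power_mult_distrib mult_ac)

text \<open>Expand \<open>(h + V)^2\<close> in the two-step factor: the terms containing
  \<open>h\<close> vanish by \<open>w_h_tendsto\<close>, and the rest contributes
  \<open>V k / V (Suc k) - 1\<close>.\<close>

lemma w_two_step_tendsto: "(\<lambda>k. w (Suc (Suc k)) $ i - w k $ i) \<longlonglongrightarrow> 0"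
proof -
  \<comment> \<open>Weights are at most 1, so \<open>(w h)^2\<close> is at most
    \<open>w h^2\<close>.\<close>
  have wh: "(\<lambda>k. w k $ i * h k (l i)) \<longlonglongrightarrow> 0"
  proof (rule power_tendsto_0_iff[THEN iffD1])
    show "(\<lambda>k. (w k $ i * h k (l i))^2) \<longlonglongrightarrow> 0"
    proof (rule tendsto_sandwich[OF _ _ tendsto_const w_h_tendsto[of i]])
      show "\<forall>\<^sub>F k in sequentially. (w k $ i * h k (l i))^2 \<le> w k $ i * (h k (l i))^2"
      proof (intro always_eventually allI)
        fix k
        have "w k $ i * w k $ i \<le> w k $ i"
          using mult_left_mono[OF w_le_1[of k i] w_nonneg[of k i]] by simp
        hence "(w k $ i * w k $ i) * (h k (l i))^2 \<le> w k $ i * (h k (l i))^2"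
          by (intro mult_right_mono) auto
        thus "(w k $ i * h k (l i))^2 \<le> w k $ i * (h k (l i))^2"
          by (simp add: power2_eq_square mult_ac)
      qed
    qed auto
  qed simp
  have "(\<lambda>k. (w k $ i * (h k (l i))^2 + 2 * V k * (w k $ i * h k (l i))) / (V k * V (Suc k)))
      \<longlonglongrightarrow> (0 + 2 * Vlim * 0) / (Vlim * Vlim)"
    using Vlim_pos by (intro tendsto_intros V_tendsto LIMSEQ_Suc w_h_tendsto wh) auto
  moreover have "(\<lambda>k. w k $ i * (V k / V (Suc k) - 1)) \<longlonglongrightarrow> 0"
  proof (rule Lim_null_comparison)
    show "\<forall>\<^sub>F k in sequentially. norm (w k $ i * (V k / V (Suc k) - 1)) \<le> \<bar>V k / V (Suc k) - 1\<bar>"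
      using w_le_1 w_nonneg by (intro always_eventually allI) (auto simp: abs_mult intro: mult_left_le_one_le)
    have "(\<lambda>k. \<bar>V k / V (Suc k) - 1\<bar>) \<longlonglongrightarrow> \<bar>Vlim / Vlim - 1\<bar>"
      using Vlim_pos by (intro tendsto_intros V_tendsto LIMSEQ_Suc) auto
    thus "(\<lambda>k. \<bar>V k / V (Suc k) - 1\<bar>) \<longlonglongrightarrow> 0" using Vlim_pos by simp
  qed
  ultimately have "(\<lambda>k. (w k $ i * (h k (l i))^2 + 2 * V k * (w k $ i * h k (l i))) / (V k * V (Suc k))
     + w k $ i * (V k / V (Suc k) - 1)) \<longlonglongrightarrow> 0"
    using tendsto_add by fastforce
  moreover have "(w k $ i * (h k (l i))^2 + 2 * V k * (w k $ i * h k (l i))) / (V k * V (Suc k))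
     + w k $ i * (V k / V (Suc k) - 1) = w (Suc (Suc k)) $ i - w k $ i" for k
    using V_pos[of k] V_pos[of "Suc k"] unfolding w_Suc_Suc
    by (simp add: field_simps power2_eq_square)
  ultimately show ?thesis by simp
qed

lemma mu_two_step_tendsto: "(\<lambda>k. \<mu> (Suc (Suc k)) - \<mu> k) \<longlonglongrightarrow> 0"
proof -
  have "(\<lambda>k. \<Sum>i\<in>UNIV. l i * (w (Suc (Suc k)) $ i - w k $ i)) \<longlonglongrightarrow> (\<Sum>i\<in>UNIV. l i * 0)"
    by (intro tendsto_intros w_two_step_tendsto)
  thus ?thesis by (simp add: weight_mean_def right_diff_distrib sum_subtractf)
qed

text \<open>By compactness, refine the subsequence until the weights converge to some
  \<open>x\<close>. The support of \<open>x\<close> lies in the roots of one quadratic, and positive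
  variance gives it two distinct points. The sum of the roots then eliminates the limit
  \<open>d\<close> of the next mean.\<close>

lemma mu_limit_point:
  assumes r: "strict_mono r" and c: "(\<lambda>j. \<mu> (r j)) \<longlonglongrightarrow> c"
  shows "\<exists>i j. (c - l i) * (l j - c) = Vlim"
proof -
  have "bounded (range (w \<circ> r))"
    unfolding bounded_iff
  proof (intro exI ballI)
    fix x assume "x \<in> range (w \<circ> r)"
    then obtain k where "x = w k" by auto
    thus "norm x \<le> 1"
      using norm_le_l1_cart[of x] w_sum[of k] w_nonneg by simp
  qed
  then obtain x q where q: "strict_mono q" and x: "((w \<circ> r) \<circ> q) \<longlonglongrightarrow> x"
    using bounded_imp_convergent_subsequence by blast
  define s where "s = r \<circ> q"
  have s: "strict_mono s" using r q by (simp add: s_def strict_mono_o)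
  have x: "(\<lambda>j. w (s j)) \<longlonglongrightarrow> x" using x by (simp add: s_def o_def)
  have xi: "(\<lambda>j. w (s j) $ i) \<longlonglongrightarrow> x $ i" for i using x by (intro tendsto_intros)
  have mu: "(\<lambda>j. \<mu> (s j)) \<longlonglongrightarrow> c" using LIMSEQ_subseq_LIMSEQ[OF c q] by (simp add: s_def o_def)
  have V: "(\<lambda>j. V (s j)) \<longlonglongrightarrow> Vlim" using LIMSEQ_subseq_LIMSEQ[OF V_tendsto s] by (simp add: o_def)
  \<comment> \<open>The limit of the following mean, from \<open>mu_Suc\<close>.\<close>
  define d where "d = c + (\<Sum>i\<in>UNIV. (l i - c)^3 * x $ i) / Vlim"
  have mu': "(\<lambda>j. \<mu> (Suc (s j))) \<longlonglongrightarrow> d"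
    unfolding mu_Suc d_def using Vlim_pos by (intro tendsto_intros mu V xi) auto
  have h: "(\<lambda>j. h (s j) t) \<longlonglongrightarrow> (t - c) * (t - d) - Vlim" for t
    unfolding h_def by (intro tendsto_intros mu mu' V)
  have root: "x $ i = 0 \<or> (l i - c) * (l i - d) = Vlim" for i
  proof -
    have "(\<lambda>j. w (s j) $ i * (h (s j) (l i))^2) \<longlonglongrightarrow> x $ i * ((l i - c) * (l i - d) - Vlim)^2"
      by (intro tendsto_intros xi h)
    moreover have "(\<lambda>j. w (s j) $ i * (h (s j) (l i))^2) \<longlonglongrightarrow> 0"
      using LIMSEQ_subseq_LIMSEQ[OF w_h_tendsto s] by (simp add: o_def)
    ultimately have "x $ i * ((l i - c) * (l i - d) - Vlim)^2 = 0" using LIMSEQ_unique by blast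
    thus ?thesis by auto
  qed
  have "(\<lambda>j. V (s j)) \<longlonglongrightarrow> (\<Sum>i\<in>UNIV. (l i - c)^2 * x $ i)"
    unfolding weight_var_def by (intro tendsto_intros mu xi)
  hence Vx: "(\<Sum>i\<in>UNIV. (l i - c)^2 * x $ i) = Vlim" using V LIMSEQ_unique by blast
  have "(\<lambda>j. \<mu> (s j)) \<longlonglongrightarrow> (\<Sum>i\<in>UNIV. l i * x $ i)"
    unfolding weight_mean_def by (intro tendsto_intros xi)
  hence mux: "(\<Sum>i\<in>UNIV. l i * x $ i) = c" using mu LIMSEQ_unique by blast
  have "(\<lambda>j. \<Sum>i\<in>UNIV. w (s j) $ i) \<longlonglongrightarrow> (\<Sum>i\<in>UNIV. x $ i)" by (intro tendsto_intros xi)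
  hence sumx: "(\<Sum>i\<in>UNIV. x $ i) = 1" by (simp add: w_sum LIMSEQ_const_iff)
  then obtain i where i: "x $ i \<noteq> 0" by (metis sum.neutral zero_neq_one)
  \<comment> \<open>A distribution concentrated at one eigenvalue would have variance 0, not
    \<open>Vlim\<close>.\<close>
  have "\<exists>j. x $ j \<noteq> 0 \<and> l j \<noteq> l i"
  proof (rule ccontr)
    assume "\<not> ?thesis"
    hence eq: "l j * x $ j = l i * x $ j" for j by auto
    have "c = l i" using mux by (simp add: eq sum_distrib_left[symmetric] sumx)
    hence "(l j - c)^2 * x $ j = 0" for j using eq[of j] by (auto simp: algebra_simps)
    hence "(\<Sum>j\<in>UNIV. (l j - c)^2 * x $ j) = 0" by (intro sum.neutral) blast
    thus False using Vx Vlim_pos by simp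
  qed
  then obtain j where j: "x $ j \<noteq> 0" "l j \<noteq> l i" by blast
  have e: "(l i - c) * (l i - d) = Vlim" "(l j - c) * (l j - d) = Vlim" using root i j by auto
  hence "(l j - l i) * (l i + l j - c - d) = 0" by (simp add: algebra_simps)
  hence d: "d = l i + l j - c" using j by simp
  have "(c - l i) * (l j - c) = Vlim" using e(1) unfolding d by (simp add: algebra_simps)
  thus ?thesis by blast
qed

text \<open>For each of the finitely many index pairs, \<open>c\<close> is a root of a quadratic
  with leading coefficient -1.\<close>

lemma mu_limit_points_finite: "finite {c. \<exists>i j. (c - l i) * (l j - c) = Vlim}"
proof -
  have "finite {c. (c - l i) * (l j - c) = Vlim}" for i j
  proof -
    have "{c. (c - l i) * (l j - c) = Vlim} = {c. poly [:- l i * l j - Vlim, l i + l j, -1:] c = 0}"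
      by (auto simp: algebra_simps)
    thus ?thesis by (simp only:) (rule poly_roots_finite, simp)
  qed
  moreover have "{c. \<exists>i j. (c - l i) * (l j - c) = Vlim} = (\<Union>i. \<Union>j. {c. (c - l i) * (l j - c) = Vlim})"
    by auto
  ultimately show ?thesis by auto
qed

lemma mu_two_step_convergent: "convergent (\<lambda>k. \<mu> (2 * k + n))"
proof (rule convergent_if_finitely_many_limit_points[OF _ _ mu_limit_points_finite])
  show "bounded (range (\<lambda>k. \<mu> (2 * k + n)))"
    using mu_bounds by (intro bounded_subset[OF bounded_closed_interval[of m M]]) (auto simp: less_imp_le)
  have "(\<lambda>k. \<mu> (Suc (Suc (2 * k + n))) - \<mu> (2 * k + n)) \<longlonglongrightarrow> 0"
    by (rule LIMSEQ_subseq_LIMSEQ[OF mu_two_step_tendsto, of "\<lambda>k. 2 * k + n", unfolded o_def])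
      (simp add: strict_mono_def)
  thus "(\<lambda>k. \<mu> (2 * Suc k + n) - \<mu> (2 * k + n)) \<longlonglongrightarrow> 0" by simp
next
  fix c assume c: "c \<notin> {c. \<exists>i j. (c - l i) * (l j - c) = Vlim}"
  show "\<exists>e>0. \<forall>\<^sub>F k in sequentially. e \<le> \<bar>\<mu> (2 * k + n) - c\<bar>"
  proof (rule ccontr)
    assume "\<not> ?thesis"
    hence "\<not> (\<forall>\<^sub>F k in sequentially. inverse (real (Suc j)) \<le> \<bar>\<mu> (2 * k + n) - c\<bar>)" for j
      by (metis inverse_positive_iff_positive of_nat_0_less_iff zero_less_Suc)
    hence ex': "\<exists>k\<ge>N. \<bar>\<mu> (2 * k + n) - c\<bar> < inverse (real (Suc j))" for N j
      unfolding eventually_sequentially by (meson not_le)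
    \<comment> \<open>Parity is now dropped: a limit point of the means of one parity is a limit
      point of all means, to which \<open>mu_limit_point\<close> applies.\<close>
    have ex: "\<exists>k>N. \<bar>\<mu> k - c\<bar> < inverse (real (Suc j))" for N j
    proof -
      obtain k where "k \<ge> Suc N" "\<bar>\<mu> (2 * k + n) - c\<bar> < inverse (real (Suc j))" using ex' by blast
      thus ?thesis by (intro exI[of _ "2 * k + n"]) auto
    qed
    obtain r where r: "strict_mono r" "\<And>j. \<bar>\<mu> (r j) - c\<bar> < inverse (real (Suc j))"
    proof -
      \<comment> \<open>Recursive choice of ever later indices, the \<open>j\<close>-th within
        \<open>1 / (j + 1)\<close> of \<open>c\<close>.\<close>
      define f where "f = rec_nat (SOME k. \<bar>\<mu> k - c\<bar> < inverse (real (Suc 0)))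
        (\<lambda>j N. SOME k. k > N \<and> \<bar>\<mu> k - c\<bar> < inverse (real (Suc (Suc j))))"
      have f_Suc: "f (Suc j) > f j \<and> \<bar>\<mu> (f (Suc j)) - c\<bar> < inverse (real (Suc (Suc j)))" for j
        using someI_ex[OF ex[of "f j" "Suc j"]] by (simp add: f_def)
      have f_0: "\<bar>\<mu> (f 0) - c\<bar> < inverse (real (Suc 0))"
        using someI_ex[of "\<lambda>k. \<bar>\<mu> k - c\<bar> < inverse (real (Suc 0))"] ex[of 0 0] by (auto simp: f_def)
      have "\<bar>\<mu> (f j) - c\<bar> < inverse (real (Suc j))" for j
        using f_0 f_Suc by (cases j) blast+
      moreover have "strict_mono f" using f_Suc by (simp add: strict_mono_Suc_iff)
      ultimately show ?thesis using that by blast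
    qed
    have "(\<lambda>j. \<mu> (r j) - c) \<longlonglongrightarrow> 0"
      by (rule Lim_null_comparison[OF _ LIMSEQ_inverse_real_of_nat])
        (use r(2) in \<open>auto simp: less_imp_le\<close>)
    hence "(\<lambda>j. \<mu> (r j)) \<longlonglongrightarrow> c" by (simp add: LIM_zero_iff)
    from mu_limit_point[OF r(1) this] c show False by auto
  qed
qed

section \<open>Limits along even indices and the loss of interior mass\<close>

definition "mu_even = lim (\<lambda>k. \<mu> (2 * k))"
definition "mu_odd = lim (\<lambda>k. \<mu> (Suc (2 * k)))"
definition "hlim t = (t - mu_even) * (t - mu_odd) - Vlim"

lemma mu_even: "(\<lambda>k. \<mu> (2 * k)) \<longlonglongrightarrow> mu_even" and mu_odd: "(\<lambda>k. \<mu> (Suc (2 * k))) \<longlonglongrightarrow> mu_odd"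
  using mu_two_step_convergent[of 0] mu_two_step_convergent[of 1]
  by (simp_all add: mu_even_def mu_odd_def convergent_LIMSEQ_iff)

lemma V_even: "(\<lambda>k. V (2 * k)) \<longlonglongrightarrow> Vlim"
  using LIMSEQ_subseq_LIMSEQ[OF V_tendsto, of "\<lambda>k. 2 * k"] by (simp add: strict_mono_def o_def)

lemma h_even: "(\<lambda>k. h (2 * k) t) \<longlonglongrightarrow> hlim t"
  unfolding h_def hlim_def by (intro tendsto_intros mu_even mu_odd V_even)

lemma w_even_tendsto_0:
  assumes "hlim (l i) \<noteq> 0"
  shows "(\<lambda>k. w (2 * k) $ i) \<longlonglongrightarrow> 0"
proof -
  have "(\<lambda>k. w (2 * k) $ i * (h (2 * k) (l i))^2 / (h (2 * k) (l i))^2) \<longlonglongrightarrow> 0 / (hlim (l i))^2"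
    using assms LIMSEQ_subseq_LIMSEQ[OF w_h_tendsto, of "\<lambda>k. 2 * k"]
    by (intro tendsto_intros h_even) (simp_all add: strict_mono_def o_def)
  moreover have "\<forall>\<^sub>F k in sequentially. h (2 * k) (l i) \<noteq> 0"
    using h_even assms by (rule tendsto_imp_eventually_ne)
  hence "\<forall>\<^sub>F k in sequentially. w (2 * k) $ i * (h (2 * k) (l i))^2 / (h (2 * k) (l i))^2 = w (2 * k) $ i"
    by eventually_elim simp
  ultimately show ?thesis using tendsto_cong by fastforce
qed

text \<open>If the limit were positive, the two-step factor would eventually exceed 1, so the
  positive weight could not decrease. Yet \<open>w_even_tendsto_0\<close> sends it to 0.\<close>

lemma hlim_le_0:
  assumes pos: "\<And>k. w k $ i > 0"
  shows "hlim (l i) \<le> 0"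
proof (rule ccontr)
  assume "\<not> ?thesis"
  hence hpos: "hlim (l i) > 0" by simp
  have "(\<lambda>k. (h (2 * k) (l i) + V (2 * k))^2 - V (2 * k) * V (Suc (2 * k)))
      \<longlonglongrightarrow> (hlim (l i) + Vlim)^2 - Vlim * Vlim"
    using LIMSEQ_subseq_LIMSEQ[OF V_tendsto, of "\<lambda>k. Suc (2 * k)"]
    by (intro tendsto_intros h_even V_even) (simp add: strict_mono_def o_def)
  moreover have "(hlim (l i) + Vlim)^2 - Vlim * Vlim > 0"
    using hpos Vlim_pos by (simp add: power2_eq_square algebra_simps add_pos_pos)
  ultimately have "\<forall>\<^sub>F k in sequentially. 0 < (h (2 * k) (l i) + V (2 * k))^2 - V (2 * k) * V (Suc (2 * k))"
    by (rule order_tendstoD)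
  hence "\<forall>\<^sub>F k in sequentially. w (2 * k) $ i \<le> w (2 * Suc k) $ i"
  proof eventually_elim
    case (elim k)
    hence "w (2 * k) $ i * (V (2 * k) * V (Suc (2 * k))) \<le> w (2 * k) $ i * (h (2 * k) (l i) + V (2 * k))^2"
      by (intro mult_left_mono w_nonneg) auto
    thus ?case using V_pos[of "2 * k"] V_pos[of "Suc (2 * k)"]
      by (simp add: w_Suc_Suc pos_le_divide_eq)
  qed
  then obtain N where N: "\<And>k. k \<ge> N \<Longrightarrow> w (2 * k) $ i \<le> w (2 * Suc k) $ i"
    by (auto simp: eventually_sequentially)
  have "w (2 * N) $ i \<le> w (2 * k) $ i" if "k \<ge> N" for k
    using that
  proof (induction k rule: dec_induct)
    case (step k)
    thus ?case using N[of k] by auto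
  qed simp
  hence "w (2 * N) $ i \<le> 0"
    using w_even_tendsto_0[of i] hpos by (intro LIMSEQ_le_const[of "\<lambda>k. w (2 * k) $ i"]) auto
  thus False using pos[of "2 * N"] by simp
qed

lemma w_interior_even:
  assumes "l i \<noteq> m" "l i \<noteq> M"
  shows "(\<lambda>k. w (2 * k) $ i) \<longlonglongrightarrow> 0"
proof (rule w_even_tendsto_0)
  have li: "m < l i" "l i < M" using assms l_bounds[of i] by auto
  have "hlim m \<le> 0" "hlim M \<le> 0"
    using hlim_le_0[of im] hlim_le_0[of iM] im(1) iM(1) w_im_pos w_iM_pos by auto
  hence "(M - l i) * hlim m \<le> 0" "(l i - m) * hlim M \<le> 0" using li by (auto simp: mult_le_0_iff)
  \<comment> \<open>A monic quadratic lies below its chord over \<open>m\<close>, \<open>M\<close>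
    by exactly \<open>(M - t) * (t - m)\<close>.\<close>
  moreover have "(M - m) * hlim (l i) = (M - l i) * hlim m + (l i - m) * hlim M - (M - m) * ((M - l i) * (l i - m))"
    by (simp add: hlim_def algebra_simps)
  moreover have "(M - m) * ((M - l i) * (l i - m)) > 0" using li by simp
  ultimately have "(M - m) * hlim (l i) < 0" by linarith
  thus "hlim (l i) \<noteq> 0" by auto
qed

lemma sum_split_weights:
  "(\<Sum>i\<in>UNIV. f (l i) * x $ i) = f m * weight_at l m x + f M * weight_at l M x
      + (\<Sum>i | l i \<noteq> m \<and> l i \<noteq> M. f (l i) * x $ i)"
proof -
  have "(UNIV :: 'i set) = {i. l i = m} \<union> ({i. l i = M} \<union> {i. l i \<noteq> m \<and> l i \<noteq> M})" by auto
  hence "(\<Sum>i\<in>UNIV. f (l i) * x $ i) = (\<Sum>i\<in>{i. l i = m} \<union> ({i. l i = M} \<union> {i. l i \<noteq> m \<and> l i \<noteq> M}). f (l i) * x $ i)"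
    by simp
  also have "\<dots> = (\<Sum>i | l i = m. f (l i) * x $ i) + ((\<Sum>i | l i = M. f (l i) * x $ i) + (\<Sum>i | l i \<noteq> m \<and> l i \<noteq> M. f (l i) * x $ i))"
    using m_less_M by (subst sum.union_disjoint; (subst sum.union_disjoint)?) auto
  finally show ?thesis by (simp add: weight_at_def sum_distrib_left)
qed

lemma weight_at_Suc: "weight_at l r (w (Suc k)) = (r - \<mu> k)^2 / V k * weight_at l r (w k)"
  by (simp add: weight_at_def w_Suc sum_distrib_left)

text \<open>With the interior mass gone, the even limit is a two-point distribution determined by
  its mean. One further step multiplies the masses by \<open>(1 - p) / p\<close> and
  \<open>p / (1 - p)\<close>, which exchanges them.\<close>

lemma weights_tendsto:
  "\<exists>p. 0 < p \<and> p < 1 \<and>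
     (\<lambda>k. weight_at l m (w (2 * k))) \<longlonglongrightarrow> p \<and> (\<lambda>k. weight_at l M (w (2 * k))) \<longlonglongrightarrow> 1 - p \<and>
     (\<lambda>k. weight_at l m (w (Suc (2 * k)))) \<longlonglongrightarrow> 1 - p \<and> (\<lambda>k. weight_at l M (w (Suc (2 * k)))) \<longlonglongrightarrow> p"
proof -
  let ?R = "\<lambda>f k. \<Sum>i | l i \<noteq> m \<and> l i \<noteq> M. f (l i) * w (2 * k) $ i"
  have R: "?R f \<longlonglongrightarrow> 0" for f
  proof -
    have "?R f \<longlonglongrightarrow> (\<Sum>i | l i \<noteq> m \<and> l i \<noteq> M. f (l i) * 0)"
      by (intro tendsto_intros w_interior_even) auto
    thus ?thesis by simp
  qed
  have split: "(\<Sum>i\<in>UNIV. f (l i) * w (2 * k) $ i) = f m * weight_at l m (w (2 * k)) + f M * weight_at l M (w (2 * k)) + ?R f k" for f k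
    by (rule sum_split_weights)
  \<comment> \<open>The only mass at \<open>m\<close> for which a distribution on \<open>m\<close>
    and \<open>M\<close> has mean \<open>mu_even\<close>.\<close>
  define p where "p = (M - mu_even) / (M - m)"
  have q: "1 - p = (mu_even - m) / (M - m)" using m_less_M by (simp add: p_def field_simps)
  have pm: "(\<lambda>k. weight_at l m (w (2 * k))) \<longlonglongrightarrow> p"
  proof -
    \<comment> \<open>The test function \<open>M - t\<close> vanishes at \<open>M\<close> and so
      isolates the mass at \<open>m\<close>; \<open>t - m\<close> does the converse below.\<close>
    have "M - \<mu> (2 * k) = (\<Sum>i\<in>UNIV. (M - l i) * w (2 * k) $ i)" for k
      by (simp add: weight_mean_def left_diff_distrib sum_subtractf sum_distrib_left[symmetric] w_sum)
    hence "(M - \<mu> (2 * k) - ?R (\<lambda>t. M - t) k) / (M - m) = weight_at l m (w (2 * k))" for k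
      using split[of "\<lambda>t. M - t" k] m_less_M by simp
    moreover have "(\<lambda>k. (M - \<mu> (2 * k) - ?R (\<lambda>t. M - t) k) / (M - m)) \<longlonglongrightarrow> (M - mu_even - 0) / (M - m)"
      using m_less_M by (intro tendsto_intros mu_even R) auto
    ultimately show ?thesis by (simp add: p_def)
  qed
  have pM: "(\<lambda>k. weight_at l M (w (2 * k))) \<longlonglongrightarrow> 1 - p"
  proof -
    have "\<mu> (2 * k) - m = (\<Sum>i\<in>UNIV. (l i - m) * w (2 * k) $ i)" for k
      by (simp add: weight_mean_def left_diff_distrib sum_subtractf sum_distrib_left[symmetric] w_sum)
    hence "(\<mu> (2 * k) - m - ?R (\<lambda>t. t - m) k) / (M - m) = weight_at l M (w (2 * k))" for k
      using split[of "\<lambda>t. t - m" k] m_less_M by simp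
    moreover have "(\<lambda>k. (\<mu> (2 * k) - m - ?R (\<lambda>t. t - m) k) / (M - m)) \<longlonglongrightarrow> (mu_even - m - 0) / (M - m)"
      using m_less_M by (intro tendsto_intros mu_even R) auto
    ultimately show ?thesis by (simp add: q)
  qed
  have me: "mu_even = M - p * (M - m)" using m_less_M by (simp add: p_def)
  \<comment> \<open>Variance of the two-point distribution. Its positivity is what puts
    \<open>p\<close> strictly between 0 and 1.\<close>
  have Vp: "Vlim = p * (1 - p) * (M - m)^2"
  proof -
    have "(m - \<mu> (2 * k))^2 * weight_at l m (w (2 * k)) + (M - \<mu> (2 * k))^2 * weight_at l M (w (2 * k))
       + (\<Sum>i | l i \<noteq> m \<and> l i \<noteq> M. (l i - \<mu> (2 * k))^2 * w (2 * k) $ i) = V (2 * k)" for k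
      using split[of "\<lambda>t. (t - \<mu> (2 * k))^2" k] by (simp add: weight_var_def)
    moreover have "(\<lambda>k. (m - \<mu> (2 * k))^2 * weight_at l m (w (2 * k)) + (M - \<mu> (2 * k))^2 * weight_at l M (w (2 * k))
       + (\<Sum>i | l i \<noteq> m \<and> l i \<noteq> M. (l i - \<mu> (2 * k))^2 * w (2 * k) $ i)) \<longlonglongrightarrow>
       (m - mu_even)^2 * p + (M - mu_even)^2 * (1 - p) + (\<Sum>i | l i \<noteq> m \<and> l i \<noteq> M. (l i - mu_even)^2 * 0)"
      by (intro tendsto_intros mu_even pm pM w_interior_even) auto
    ultimately have "Vlim = (m - mu_even)^2 * p + (M - mu_even)^2 * (1 - p)"
      using LIMSEQ_unique[OF V_even] by simp
    thus ?thesis by (simp add: me power2_eq_square algebra_simps)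
  qed
  have "p * (1 - p) > 0" using Vlim_pos m_less_M unfolding Vp by (simp add: zero_less_mult_iff)
  hence p: "0 < p" "p < 1" by (auto simp: zero_less_mult_iff)
  have "(\<lambda>k. weight_at l m (w (Suc (2 * k)))) \<longlonglongrightarrow> (m - mu_even)^2 / Vlim * p"
    unfolding weight_at_Suc using Vlim_pos by (intro tendsto_intros mu_even V_even pm) auto
  moreover have "(m - mu_even)^2 / Vlim * p = 1 - p"
  proof -
    have "m - mu_even = - ((1 - p) * (M - m))" by (simp add: me algebra_simps)
    thus ?thesis using p m_less_M by (simp add: Vp power2_eq_square)
  qed
  moreover have "(\<lambda>k. weight_at l M (w (Suc (2 * k)))) \<longlonglongrightarrow> (M - mu_even)^2 / Vlim * (1 - p)"
    unfolding weight_at_Suc using Vlim_pos by (intro tendsto_intros mu_even V_even pM) auto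
  moreover have "(M - mu_even)^2 / Vlim * (1 - p) = p"
    using p m_less_M by (simp add: Vp me power2_eq_square)
  ultimately show ?thesis using p pm pM by (intro exI[of _ p]) simp
qed

end

section \<open>From weights to vectors\<close>

definition coord_weights :: "('n \<Rightarrow> real^'n) \<Rightarrow> real^'n \<Rightarrow> real^'n" where
  "coord_weights b z = (\<chi> i. (z \<bullet> b i)^2)"

text \<open>For orthonormal \<open>b\<close>, the orthogonal projection of \<open>z\<close> onto the
  \<open>r\<close>-eigenspace of \<open>spectral_matrix b l\<close>.\<close>

definition spectral_component :: "('n \<Rightarrow> real^'n) \<Rightarrow> ('n \<Rightarrow> real) \<Rightarrow> real \<Rightarrow> real^'n \<Rightarrow> real^'n" where
  "spectral_component b l r z = (\<Sum>i | l i = r. (z \<bullet> b i) *\<^sub>R b i)"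

lemma spectral_component_inner:
  assumes "orthonormal_family b"
  shows "spectral_component b l r z \<bullet> b i = (if l i = r then z \<bullet> b i else 0)"
  by (simp add: spectral_component_def inner_sum_left orthonormal_family_inner[OF assms] if_distrib
      cong: if_cong)

lemma spectral_component_inner_vec:
  assumes b: "orthonormal_family b"
  shows "spectral_component b l r z \<bullet> z = weight_at l r (coord_weights b z)"
    and "spectral_component b l r z \<bullet> spectral_component b l r z = weight_at l r (coord_weights b z)"
  by (subst orthonormal_inner[OF b], simp add: spectral_component_inner[OF b] weight_at_def
      coord_weights_def power2_eq_square sum.If_cases if_distrib[of "\<lambda>x. x * _"] if_distribR cong: if_cong)+

lemma spectral_component_orthogonal:
  assumes b: "orthonormal_family b" and "r \<noteq> s"
  shows "spectral_component b l r z \<bullet> spectral_component b l s z = 0"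
  by (subst orthonormal_inner[OF b], intro sum.neutral)
    (use assms(2) in \<open>auto simp: spectral_component_inner[OF b]\<close>)

lemma spectral_component_eigen:
  assumes b: "orthonormal_family b"
  shows "spectral_matrix b l *v spectral_component b l r z = r *\<^sub>R spectral_component b l r z"
  by (rule orthonormal_eqI[OF b]) (simp add: spectral_matrix_inner[OF b] spectral_component_inner[OF b])

text \<open>The vectors \<open>u\<close> and \<open>v\<close> arise by rotating \<open>z\<close> and a unit vector \<open>t\<close> orthogonal to \<open>z\<close>; \<open>t\<close>
  is chosen such that the rotation asymptotically separates the two extreme components of \<open>z\<close>.\<close>

lemma two_point_decomposition:
  fixes b :: "'n \<Rightarrow> real^'n" and z :: "nat \<Rightarrow> real^'n"
  assumes b: "orthonormal_family b" and mM: "m \<noteq> M" and dim: "CARD('n) \<ge> 2" and a: "0 < a" "a < 1"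
    and norm_z: "\<And>k. norm (z k) = 1"
    and lim_m: "(\<lambda>k. weight_at l m (coord_weights b (z k))) \<longlonglongrightarrow> a"
    and lim_M: "(\<lambda>k. weight_at l M (coord_weights b (z k))) \<longlonglongrightarrow> 1 - a"
  obtains u v where "\<And>k. z k = sqrt a *\<^sub>R u k + sqrt (1 - a) *\<^sub>R v k"
    and "\<And>k. norm (u k) = 1" and "\<And>k. norm (v k) = 1"
    and "(\<lambda>k. spectral_matrix b l *v u k - m *\<^sub>R u k) \<longlonglongrightarrow> 0"
    and "(\<lambda>k. spectral_matrix b l *v v k - M *\<^sub>R v k) \<longlonglongrightarrow> 0"
proof -
  define \<alpha> where "\<alpha> = sqrt a"
  define \<beta> where "\<beta> = sqrt (1 - a)"
  have ab: "\<alpha> > 0" "\<beta> > 0" "\<alpha>^2 = a" "\<beta>^2 = 1 - a" using a by (simp_all add: \<alpha>_def \<beta>_def)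
  define e where "e k = spectral_component b l m (z k)" for k
  define f where "f k = spectral_component b l M (z k)" for k
  define q where "q k = weight_at l m (coord_weights b (z k))" for k
  define r where "r k = weight_at l M (coord_weights b (z k))" for k
  have zz: "z k \<bullet> z k = 1" for k using norm_z by (simp add: dot_square_norm)
  have in1: "e k \<bullet> z k = q k" "e k \<bullet> e k = q k" "f k \<bullet> z k = r k" "f k \<bullet> f k = r k" "e k \<bullet> f k = 0" for k
    using spectral_component_inner_vec[OF b] spectral_component_orthogonal[OF b mM]
    by (simp_all add: e_def f_def q_def r_def)
  have in2: "z k \<bullet> e k = q k" "z k \<bullet> f k = r k" "f k \<bullet> e k = 0" for k
    using in1[of k] by (simp_all add: inner_commute)
  have q: "q \<longlonglongrightarrow> a" and r: "r \<longlonglongrightarrow> 1 - a" using lim_m lim_M by (simp_all add: q_def[abs_def] r_def[abs_def])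
  \<comment> \<open>In the ideal case \<open>e = \<alpha> u\<close> and
    \<open>f = \<beta> v\<close>, this is \<open>\<beta> u - \<alpha> v\<close>, the unit vector
    orthogonal to \<open>z\<close>. In general \<open>y\<close> corrects \<open>w\<close> to be
    orthogonal to \<open>z\<close>, and the correction \<open>s\<close> tends to 0.\<close>
  define w where "w k = (\<beta> / \<alpha>) *\<^sub>R e k - (\<alpha> / \<beta>) *\<^sub>R f k" for k
  define s where "s k = w k \<bullet> z k" for k
  define y where "y k = w k - s k *\<^sub>R z k" for k
  have s_eq: "s k = \<beta> / \<alpha> * q k - \<alpha> / \<beta> * r k" for k
    by (simp add: s_def w_def inner_diff_left in1)
  have "s \<longlonglongrightarrow> \<beta> / \<alpha> * \<alpha>^2 - \<alpha> / \<beta> * \<beta>^2"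
    unfolding s_eq ab(3,4) by (intro tendsto_intros q r)
  moreover have "\<beta> / \<alpha> * \<alpha>^2 - \<alpha> / \<beta> * \<beta>^2 = 0" using ab(1,2) by (simp add: power2_eq_square)
  ultimately have s: "s \<longlonglongrightarrow> 0" by simp
  have ww: "w k \<bullet> w k = (\<beta> / \<alpha>)^2 * q k + (\<alpha> / \<beta>)^2 * r k" for k
    by (simp add: w_def inner_diff_left inner_diff_right in1 in2 power2_eq_square)
  have yz: "y k \<bullet> z k = 0" for k by (simp add: y_def inner_diff_left zz s_def)
  have yy: "y k \<bullet> y k = (\<beta> / \<alpha>)^2 * q k + (\<alpha> / \<beta>)^2 * r k - (s k)^2" for k
    unfolding ww[symmetric]
    by (simp add: y_def inner_diff_left inner_diff_right zz s_def inner_commute[of "z k"] power2_eq_square)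
  have "(\<lambda>k. y k \<bullet> y k) \<longlonglongrightarrow> (\<beta> / \<alpha>)^2 * \<alpha>^2 + (\<alpha> / \<beta>)^2 * \<beta>^2 - 0^2"
    unfolding yy ab(3,4) by (intro tendsto_intros q r s)
  moreover have "(\<beta> / \<alpha>)^2 * \<alpha>^2 + (\<alpha> / \<beta>)^2 * \<beta>^2 - 0^2 = 1"
    using ab a by (simp add: power_divide)
  ultimately have "(\<lambda>k. sqrt (y k \<bullet> y k)) \<longlonglongrightarrow> sqrt 1" by (intro tendsto_intros) simp
  hence ny: "(\<lambda>k. norm (y k)) \<longlonglongrightarrow> 1" by (simp add: norm_eq_sqrt_inner)
  \<comment> \<open>Where \<open>y k\<close> vanishes, which happens for finitely many
    \<open>k\<close> only, any unit vector orthogonal to \<open>z k\<close> serves; dimension at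
    least 2 provides one.\<close>
  have "\<exists>t. norm t = 1 \<and> t \<bullet> z k = 0 \<and> (y k \<noteq> 0 \<longrightarrow> t = y k /\<^sub>R norm (y k))" for k
  proof (cases "y k = 0")
    case True
    obtain x where "x \<noteq> 0" "orthogonal (z k) x"
      using orthogonal_to_vector_exists[of "z k"] dim by auto
    thus ?thesis using True
      by (intro exI[of _ "x /\<^sub>R norm x"]) (simp add: orthogonal_def inner_commute)
  qed (use yz in auto)
  then obtain t where t: "\<And>k. norm (t k) = 1" "\<And>k. t k \<bullet> z k = 0" "\<And>k. y k \<noteq> 0 \<Longrightarrow> t k = y k /\<^sub>R norm (y k)"
    by metis
  have tt: "t k \<bullet> t k = 1" "z k \<bullet> t k = 0" for k using t by (simp_all add: dot_square_norm inner_commute)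
  have tw: "(\<lambda>k. t k - w k) \<longlonglongrightarrow> 0"
  proof (rule Lim_null_comparison)
    have "\<forall>\<^sub>F k in sequentially. norm (y k) > 0"
      using order_tendstoD(1)[OF ny, of 0] by simp
    thus "\<forall>\<^sub>F k in sequentially. norm (t k - w k) \<le> \<bar>1 - norm (y k)\<bar> + \<bar>s k\<bar>"
    proof eventually_elim
      case (elim k)
      have "t k - w k = (t k - norm (y k) *\<^sub>R t k) - s k *\<^sub>R z k"
        using t(3)[of k] elim by (simp add: y_def)
      also have "norm \<dots> \<le> norm ((1 - norm (y k)) *\<^sub>R t k) + norm (s k *\<^sub>R z k)"
        by (metis norm_triangle_ineq4 scaleR_left_diff_distrib scaleR_one)
      finally show ?case by (simp add: t norm_z)
    qed
    have "(\<lambda>k. \<bar>1 - norm (y k)\<bar> + \<bar>s k\<bar>) \<longlonglongrightarrow> \<bar>1 - 1\<bar> + \<bar>0\<bar>"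
      by (intro tendsto_intros ny s)
    thus "(\<lambda>k. \<bar>1 - norm (y k)\<bar> + \<bar>s k\<bar>) \<longlonglongrightarrow> 0" by simp
  qed
  have zef: "(\<lambda>k. z k - e k - f k) \<longlonglongrightarrow> 0"
  proof -
    have "(z k - e k - f k) \<bullet> (z k - e k - f k) = 1 - q k - r k" for k
      by (simp add: inner_diff_left inner_diff_right zz in1 in2)
    hence "(\<lambda>k. norm (z k - e k - f k)) = (\<lambda>k. sqrt (1 - q k - r k))"
      by (simp add: norm_eq_sqrt_inner)
    moreover have "(\<lambda>k. sqrt (1 - q k - r k)) \<longlonglongrightarrow> sqrt (1 - a - (1 - a))"
      by (intro tendsto_intros q r)
    moreover have "sqrt (1 - a - (1 - a)) = 0" by simp
    ultimately have "(\<lambda>k. norm (z k - e k - f k)) \<longlonglongrightarrow> 0" by (simp only:)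
    thus ?thesis by (rule tendsto_norm_zero_cancel)
  qed
  \<comment> \<open>Solves \<open>z = \<alpha> u + \<beta> v\<close>,
    \<open>t = \<beta> u - \<alpha> v\<close>. The decomposition and the unit norms are thus exact
    for every \<open>k\<close>; only the eigenvector property is asymptotic.\<close>
  define u where "u k = \<alpha> *\<^sub>R z k + \<beta> *\<^sub>R t k" for k
  define v where "v k = \<beta> *\<^sub>R z k - \<alpha> *\<^sub>R t k" for k
  have ab1: "\<alpha> * \<alpha> + \<beta> * \<beta> = 1" using ab by (simp add: power2_eq_square)
  have approx: "(\<lambda>k. spectral_matrix b l *v x k - \<rho> *\<^sub>R x k) \<longlonglongrightarrow> 0"
    if c: "\<And>k. spectral_matrix b l *v c k = \<rho> *\<^sub>R c k" and x: "(\<lambda>k. x k - c k) \<longlonglongrightarrow> 0" for x c :: "nat \<Rightarrow> real^'n" and \<rho>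
  proof -
    have "(\<lambda>k. spectral_matrix b l *v (x k - c k) - \<rho> *\<^sub>R (x k - c k)) \<longlonglongrightarrow> spectral_matrix b l *v 0 - \<rho> *\<^sub>R 0"
      by (intro tendsto_intros x bounded_linear.tendsto[OF matrix_vector_mul_bounded_linear])
    thus ?thesis by (simp add: matrix_vector_mult_diff_distrib c algebra_simps)
  qed
  show ?thesis
  proof (rule that)
    show "z k = sqrt a *\<^sub>R u k + sqrt (1 - a) *\<^sub>R v k" for k
    proof -
      have "\<alpha> *\<^sub>R u k + \<beta> *\<^sub>R v k = (\<alpha> * \<alpha> + \<beta> * \<beta>) *\<^sub>R z k"
        by (simp add: u_def v_def algebra_simps)
      thus ?thesis unfolding ab1 by (simp add: \<alpha>_def \<beta>_def)
    qed
    show "norm (u k) = 1" for k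
      by (simp add: norm_eq_sqrt_inner u_def inner_add_left inner_add_right zz tt t(2) ab1)
    show "norm (v k) = 1" for k
      using ab1 by (simp add: norm_eq_sqrt_inner v_def inner_diff_left inner_diff_right zz tt t(2))
    have "u k - (1 / \<alpha>) *\<^sub>R e k = \<alpha> *\<^sub>R (z k - e k - f k) + \<beta> *\<^sub>R (t k - w k)" for k
    proof -
      have "\<alpha> *\<^sub>R (z k - e k - f k) + \<beta> *\<^sub>R (t k - w k) = u k - (\<alpha> + \<beta> * (\<beta> / \<alpha>)) *\<^sub>R e k - (\<alpha> - \<beta> * (\<alpha> / \<beta>)) *\<^sub>R f k"
        by (simp add: u_def w_def algebra_simps)
      moreover have "\<alpha> + \<beta> * (\<beta> / \<alpha>) = 1 / \<alpha>" "\<alpha> - \<beta> * (\<alpha> / \<beta>) = 0"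
        using ab ab1 by (simp_all add: field_simps)
      ultimately show ?thesis by simp
    qed
    moreover have "(\<lambda>k. \<alpha> *\<^sub>R (z k - e k - f k) + \<beta> *\<^sub>R (t k - w k)) \<longlonglongrightarrow> \<alpha> *\<^sub>R 0 + \<beta> *\<^sub>R 0"
      by (intro tendsto_intros zef tw)
    ultimately show "(\<lambda>k. spectral_matrix b l *v u k - m *\<^sub>R u k) \<longlonglongrightarrow> 0"
      by (intro approx[of "\<lambda>k. (1 / \<alpha>) *\<^sub>R e k"])
        (simp_all add: e_def matrix_vector_mult_scaleR spectral_component_eigen[OF b])
    have "v k - (1 / \<beta>) *\<^sub>R f k = \<beta> *\<^sub>R (z k - e k - f k) - \<alpha> *\<^sub>R (t k - w k)" for k
    proof -
      have "\<beta> *\<^sub>R (z k - e k - f k) - \<alpha> *\<^sub>R (t k - w k) = v k - (\<beta> - \<alpha> * (\<beta> / \<alpha>)) *\<^sub>R e k - (\<beta> + \<alpha> * (\<alpha> / \<beta>)) *\<^sub>R f k"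
        by (simp add: v_def w_def algebra_simps)
      moreover have "\<beta> + \<alpha> * (\<alpha> / \<beta>) = 1 / \<beta>" "\<beta> - \<alpha> * (\<beta> / \<alpha>) = 0"
        using ab ab1 by (simp_all add: field_simps)
      ultimately show ?thesis by simp
    qed
    moreover have "(\<lambda>k. \<beta> *\<^sub>R (z k - e k - f k) - \<alpha> *\<^sub>R (t k - w k)) \<longlonglongrightarrow> \<beta> *\<^sub>R 0 - \<alpha> *\<^sub>R 0"
      by (intro tendsto_intros zef tw)
    ultimately show "(\<lambda>k. spectral_matrix b l *v v k - M *\<^sub>R v k) \<longlonglongrightarrow> 0"
      by (intro approx[of "\<lambda>k. (1 / \<beta>) *\<^sub>R f k"])
        (simp_all add: f_def matrix_vector_mult_scaleR spectral_component_eigen[OF b])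
  qed
qed

section \<open>The algorithm step in spectral coordinates\<close>

lemma arg_min_quadratic:
  fixes n0 n1 n2 :: real
  assumes "is_arg_min f (\<lambda>_. True) \<gamma>" and f: "\<And>t. f t = n0 - 2 * t * n1 + t^2 * n2" and n2: "n2 > 0"
  shows "\<gamma> * n2 = n1"
proof -
  have "f \<gamma> \<le> f (n1 / n2)" using assms(1) by (auto simp: is_arg_min_def not_less)
  \<comment> \<open>Comparison with the vertex; the factor \<open>n2\<close> completes the
    square.\<close>
  hence "n2 * (- 2 * \<gamma> * n1 + \<gamma>^2 * n2) \<le> n2 * (- 2 * (n1 / n2) * n1 + (n1 / n2)^2 * n2)"
    using n2 by (intro mult_left_mono) (auto simp: f)
  also have "\<dots> = - (n1^2)" using n2 by (simp add: field_simps power2_eq_square)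
  finally have "(\<gamma> * n2 - n1)^2 \<le> 0" by (simp add: power2_eq_square algebra_simps)
  thus ?thesis by simp
qed

text \<open>The map followed by the renormalised gradients. It involves neither \<open>P\<close> nor
  \<open>y\<close>, so the whole orbit is determined by \<open>A\<close> and
  \<open>z 0\<close>.\<close>

definition renorm_step :: "real^'n^'n \<Rightarrow> real^'n \<Rightarrow> real^'n" where
  "renorm_step A z = (1 / norm (A *v z - ((A *v z) \<bullet> z) *\<^sub>R z)) *\<^sub>R (((A *v z) \<bullet> z) *\<^sub>R z - A *v z)"

text \<open>The Rayleigh quotient is the mean of the spectral weights, and the norm of the residual
  is their standard deviation.\<close>

lemma renorm_step_coords:
  assumes b: "orthonormal_family b"
  shows "renorm_step (spectral_matrix b l) z \<bullet> b i =
    (weight_mean l (coord_weights b z) - l i) * (z \<bullet> b i) / sqrt (weight_var l (coord_weights b z))"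
proof -
  have mean: "(spectral_matrix b l *v z) \<bullet> z = weight_mean l (coord_weights b z)"
    by (simp add: orthonormal_inner[OF b, of _ z] spectral_matrix_inner[OF b] weight_mean_def
        coord_weights_def power2_eq_square mult.assoc)
  have "norm (spectral_matrix b l *v z - r *\<^sub>R z) = sqrt (\<Sum>i\<in>UNIV. (l i - r)^2 * coord_weights b z $ i)" for r
    unfolding norm_eq_sqrt_inner
    by (subst orthonormal_inner[OF b]) (simp add: inner_diff_left spectral_matrix_inner[OF b] coord_weights_def power2_eq_square algebra_simps)
  thus ?thesis
    by (simp add: renorm_step_def mean weight_var_def inner_diff_left spectral_matrix_inner[OF b] algebra_simps
        diff_divide_distrib)
qed

lemma renorm_grad_coords:
  assumes b: "orthonormal_family b" and A: "A = spectral_matrix b l" and Q: "Q = spectral_matrix b f"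
    and pos: "\<And>i. 0 < l i" "\<And>i. 0 < f i"
  shows "renorm_grad A y Q x \<bullet> b i =
    sqrt (f i * l i) * (quad_grad A y x \<bullet> b i) / sqrt (\<Sum>j\<in>UNIV. f j * l j * (quad_grad A y x \<bullet> b j)^2)"
proof -
  have "Q ** A = spectral_matrix b (\<lambda>i. f i * l i)" by (simp add: A Q spectral_matrix_mult[OF b])
  moreover have "pos_sqrt_matrix (spectral_matrix b (\<lambda>i. f i * l i)) = spectral_matrix b (\<lambda>i. sqrt (f i * l i))"
    by (rule pos_sqrt_matrix_spectral_matrix[OF b]) (simp add: pos)
  moreover have "(spectral_matrix b h *v g) \<bullet> g = (\<Sum>j\<in>UNIV. h j * (g \<bullet> b j)^2)" for h g
    by (simp add: orthonormal_inner[OF b, of _ g] spectral_matrix_inner[OF b] power2_eq_square mult.assoc)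
  ultimately show ?thesis by (simp add: renorm_grad_def spectral_matrix_inner[OF b])
qed

text \<open>The optimal step-length is \<open>1 / \<mu>\<close> for the mean \<open>\<mu>\<close> of
  the spectral weights, so a step multiplies the \<open>i\<close>-th gradient coordinate by
  \<open>(\<mu> - l i) / \<mu>\<close>. Renormalising replaces the denominator by the standard
  deviation and cancels \<open>P\<close>.\<close>

lemma gradient_algorithm_renorm_step:
  assumes b: "orthonormal_family b" and A: "A = spectral_matrix b l" and Q: "Q = spectral_matrix b f"
    and pos: "\<And>i. 0 < l i" "\<And>i. 0 < f i" and alg: "gradient_algorithm A y Q x \<gamma>"
  shows "renorm_grad A y Q (x (Suc k)) = renorm_step A (renorm_grad A y Q (x k))"
proof -
  define g where "g k = quad_grad A y (x k)" for k
  define z where "z k = renorm_grad A y Q (x k)" for k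
  \<comment> \<open>The eigenvalues of \<open>Q ** A\<close>, the matrix behind the
    renormalisation.\<close>
  define D where "D i = f i * l i" for i
  have D: "D i > 0" for i using pos by (simp add: D_def)
  define n where "n k = (\<Sum>j\<in>UNIV. D j * (g k \<bullet> b j)^2)" for k
  have zc: "z k \<bullet> b i = sqrt (D i) * (g k \<bullet> b i) / sqrt (n k)" for k i
    unfolding z_def n_def D_def g_def by (rule renorm_grad_coords[OF b A Q pos])
  have line: "quad_grad A y (x k - t *\<^sub>R g k) = g k - t *\<^sub>R (A *v g k)" for t
    by (simp add: quad_grad_def g_def matrix_vector_mult_diff_distrib matrix_vector_mult_scaleR)
  have step: "g (Suc k) = g k - \<gamma> k *\<^sub>R (A *v g k)"
  proof -
    have "x (Suc k) = x k - \<gamma> k *\<^sub>R g k" using alg by (simp add: gradient_algorithm_def g_def)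
    thus ?thesis using line[of "\<gamma> k"] by (simp add: g_def)
  qed
  have gc: "g (Suc k) \<bullet> b i = (1 - \<gamma> k * l i) * (g k \<bullet> b i)" for i
    unfolding step by (simp add: inner_diff_left A spectral_matrix_inner[OF b] algebra_simps)
  have "z (Suc k) = renorm_step A (z k)"
  proof (cases "g k = 0")
    case True
    have "z k = 0" "z (Suc k) = 0" using True
      by (auto intro!: orthonormal_eqI[OF b] simp: zc gc)
    thus ?thesis by (simp add: renorm_step_def)
  next
    case False
    then obtain i0 where i0: "g k \<bullet> b i0 \<noteq> 0" using orthonormal_eqI[OF b, of "g k" 0] by auto
    have npos: "n k > 0"
      unfolding n_def by (rule sum_pos2[of _ i0]) (use i0 D in \<open>auto simp: less_imp_le\<close>)
    define n2 where "n2 = (\<Sum>j\<in>UNIV. D j * l j * (g k \<bullet> b j)^2)"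
    have n2pos: "n2 > 0"
      unfolding n2_def by (rule sum_pos2[of _ i0]) (use i0 D pos in \<open>auto simp: less_imp_le\<close>)
    have "\<gamma> k * n2 = n k"
    proof (rule arg_min_quadratic)
      show "is_arg_min (\<lambda>t. (Q *v quad_grad A y (x k - t *\<^sub>R g k)) \<bullet> quad_grad A y (x k - t *\<^sub>R g k)) (\<lambda>_. True) (\<gamma> k)"
        using alg by (simp add: gradient_algorithm_def g_def)
      show "n2 > 0" by fact
      fix t
      have "(Q *v quad_grad A y (x k - t *\<^sub>R g k)) \<bullet> quad_grad A y (x k - t *\<^sub>R g k)
          = (\<Sum>j\<in>UNIV. f j * (g k \<bullet> b j)^2 - 2 * t * (D j * (g k \<bullet> b j)^2) + t^2 * (D j * l j * (g k \<bullet> b j)^2))"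
        unfolding line unfolding Q A
        by (subst orthonormal_inner[OF b], intro sum.cong)
          (auto simp: spectral_matrix_inner[OF b] inner_diff_left D_def power2_eq_square algebra_simps)
      also have "\<dots> = (\<Sum>j\<in>UNIV. f j * (g k \<bullet> b j)^2) - 2 * t * n k + t^2 * n2"
        by (simp only: sum.distrib sum_subtractf sum_distrib_left[symmetric] n_def n2_def)
      finally show "(Q *v quad_grad A y (x k - t *\<^sub>R g k)) \<bullet> quad_grad A y (x k - t *\<^sub>R g k)
        = (\<Sum>j\<in>UNIV. f j * (g k \<bullet> b j)^2) - 2 * t * n k + t^2 * n2" .
    qed
    define \<mu> where "\<mu> = weight_mean l (coord_weights b (z k))"
    define V where "V = weight_var l (coord_weights b (z k))"
    have cw: "coord_weights b (z k) $ i = D i * (g k \<bullet> b i)^2 / n k" for i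
      using D npos by (simp add: coord_weights_def zc power_divide power_mult_distrib less_imp_le)
    have mu: "\<mu> = n2 / n k"
      by (simp add: \<mu>_def weight_mean_def cw n2_def sum_divide_distrib mult_ac)
    have mupos: "\<mu> > 0" using npos n2pos by (simp add: mu)
    have gam: "\<gamma> k = 1 / \<mu>" using \<open>\<gamma> k * n2 = n k\<close> npos n2pos by (simp add: mu field_simps)
    have gc': "g (Suc k) \<bullet> b i = (\<mu> - l i) * (g k \<bullet> b i) / \<mu>" for i
      unfolding gc gam using mupos by (simp add: field_simps)
    have "n (Suc k) = (\<Sum>j\<in>UNIV. (n k / \<mu>^2) * ((l j - \<mu>)^2 * (D j * (g k \<bullet> b j)^2 / n k)))"
      unfolding n_def[of "Suc k"] gc' using npos mupos
      by (intro sum.cong) (auto simp: field_simps power2_eq_square)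
    also have "\<dots> = n k / \<mu>^2 * V"
      unfolding sum_distrib_left[symmetric] V_def weight_var_def cw \<mu>_def[symmetric] ..
    finally have sn: "sqrt (n (Suc k)) = sqrt (n k) * sqrt V / \<mu>"
      using mupos by (simp add: real_sqrt_mult real_sqrt_divide)
    show ?thesis
    proof (rule orthonormal_eqI[OF b])
      fix i
      \<comment> \<open>If \<open>V = 0\<close>, the new gradient vanishes and both sides are 0 by
        division by zero.\<close>
      show "z (Suc k) \<bullet> b i = renorm_step A (z k) \<bullet> b i"
        unfolding A renorm_step_coords[OF b] \<mu>_def[symmetric] V_def[symmetric]
        unfolding zc gc' sn using mupos npos by (cases "V = 0") (simp_all add: field_simps)
    qed
  qed
  thus ?thesis by (simp add: z_def)
qed

section \<open>Assembly of the even and odd subsequences\<close>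

lemma tendsto_even_odd:
  fixes f :: "nat \<Rightarrow> 'a::topological_space"
  assumes "(\<lambda>k. f (2 * k)) \<longlonglongrightarrow> L" and "(\<lambda>k. f (Suc (2 * k))) \<longlonglongrightarrow> L"
  shows "f \<longlonglongrightarrow> L"
proof (rule topological_tendstoI)
  fix S assume "open S" "L \<in> S"
  with assms obtain N1 N2 where N: "\<And>k. k \<ge> N1 \<Longrightarrow> f (2 * k) \<in> S" "\<And>k. k \<ge> N2 \<Longrightarrow> f (Suc (2 * k)) \<in> S"
    unfolding tendsto_def eventually_sequentially by meson
  have "f n \<in> S" if n: "n \<ge> 2 * N1 + 2 * N2 + 1" for n
  proof (cases "even n")
    case True
    then obtain k where "n = 2 * k" by (elim evenE)
    thus ?thesis using N(1)[of k] n by simp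
  next
    case False
    then obtain k where "n = Suc (2 * k)" by (elim oddE) simp
    thus ?thesis using N(2)[of k] n by simp
  qed
  thus "\<forall>\<^sub>F n in sequentially. f n \<in> S" by (auto simp: eventually_sequentially)
qed

theorem theorem1:
  fixes A :: "real^'n^'n" and y :: "real^'n"
    and m M :: real
    and P :: "real \<Rightarrow> real" and c :: "int \<Rightarrow> real"
  assumes "pos_def_matrix A"
    and "m \<in> eigenvalues A" and "\<And>l. l \<in> eigenvalues A \<Longrightarrow> m \<le> l"
    and "M \<in> eigenvalues A" and "\<And>l. l \<in> eigenvalues A \<Longrightarrow> l \<le> M"
    and "0 < m" and "m < M"
    and "infinitely_differentiable_on P {m..M}"
    and "\<And>t. t \<in> {m..M} \<Longrightarrow> laurent_sums (\<lambda>k. c k * t powi k) (P t)"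
    and "\<And>t. t \<in> {m..M} \<Longrightarrow> 0 < P t"
  shows "\<exists>p :: real^'n \<Rightarrow> real. \<forall>(x :: nat \<Rightarrow> real^'n) (\<gamma> :: nat \<Rightarrow> real) (z :: nat \<Rightarrow> real^'n).
    gradient_algorithm A y (laurent_matrix c A) x \<gamma> \<and>
    (\<forall>k. z k = renorm_grad A y (laurent_matrix c A) (x k)) \<and>
    orth_projector (eigenspace A m) (z 0) \<noteq> 0 \<and>
    orth_projector (eigenspace A M) (z 0) \<noteq> 0 \<longrightarrow>
      0 < p (z 0) \<and> p (z 0) < 1 \<and>
      (\<exists>u v :: nat \<Rightarrow> real^'n.
        (\<forall>k. z (2 * k) = sqrt (p (z 0)) *\<^sub>R u (2 * k) + sqrt (1 - p (z 0)) *\<^sub>R v (2 * k)) \<and>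
        (\<forall>k. z (2 * k + 1) =
               sqrt (1 - p (z 0)) *\<^sub>R u (2 * k + 1) - sqrt (p (z 0)) *\<^sub>R v (2 * k + 1)) \<and>
        (\<forall>n. norm (u n) = 1 \<and> norm (v n) = 1) \<and>
        (\<lambda>n. norm (A *v u n - m *\<^sub>R u n)) \<longlonglongrightarrow> 0 \<and>
        (\<lambda>n. norm (A *v v n - M *\<^sub>R v n)) \<longlonglongrightarrow> 0)"
proof -
  have "transpose A = A" using assms(1) by (simp add: pos_def_matrix_def)
  then obtain b l where b: "orthonormal_family b" and eig: "\<And>i. A *v b i = l i *\<^sub>R b i"
    using symmetric_matrix_eigenbasis by blast
  have A: "A = spectral_matrix b l" by (rule spectral_matrixI[OF b eig])
  have "b i \<noteq> 0" for i using orthonormal_family_inner[OF b, of i i] by auto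
  hence "l i \<in> eigenvalues A" for i using eig by (auto simp: eigenvalues_def eigenspace_def)
  hence l: "m \<le> l i" "l i \<le> M" for i using assms(3,5) by auto
  have lpos: "0 < l i" and lnz: "l i \<noteq> 0" for i using l[of i] assms(6) by auto
  define Q where "Q = laurent_matrix c A"
  have Q: "Q = spectral_matrix b (\<lambda>i. P (l i))"
    unfolding Q_def A using l by (intro laurent_matrix_spectral_matrix[OF b lnz] assms(9)) auto
  have Ppos: "0 < P (l i)" for i using l assms(10) by auto
  \<comment> \<open>Defined through the orbit of \<open>renorm_step\<close>, \<open>p\<close> is a
    function of the starting vector alone, fixed before \<open>x\<close>, \<open>\<gamma>\<close>
    and \<open>z\<close> are chosen.\<close>
  define p where "p z0 = lim (\<lambda>k. weight_at l m (coord_weights b ((renorm_step A ^^ (2 * k)) z0)))" for z0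
  have main: "0 < p (z 0) \<and> p (z 0) < 1 \<and>
      (\<exists>u v :: nat \<Rightarrow> real^'n.
        (\<forall>k. z (2 * k) = sqrt (p (z 0)) *\<^sub>R u (2 * k) + sqrt (1 - p (z 0)) *\<^sub>R v (2 * k)) \<and>
        (\<forall>k. z (2 * k + 1) =
               sqrt (1 - p (z 0)) *\<^sub>R u (2 * k + 1) - sqrt (p (z 0)) *\<^sub>R v (2 * k + 1)) \<and>
        (\<forall>n. norm (u n) = 1 \<and> norm (v n) = 1) \<and>
        (\<lambda>n. norm (A *v u n - m *\<^sub>R u n)) \<longlonglongrightarrow> 0 \<and>
        (\<lambda>n. norm (A *v v n - M *\<^sub>R v n)) \<longlonglongrightarrow> 0)"
    if alg: "gradient_algorithm A y Q x \<gamma>" and z: "\<And>k. z k = renorm_grad A y Q (x k)"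
      and Em: "orth_projector (eigenspace A m) (z 0) \<noteq> 0" and EM: "orth_projector (eigenspace A M) (z 0) \<noteq> 0"
    for x \<gamma> and z :: "nat \<Rightarrow> real^'n"
  proof -
    let ?w = "\<lambda>k. coord_weights b (z k)"
    have zSuc: "z (Suc k) = renorm_step A (z k)" for k
      unfolding z by (rule gradient_algorithm_renorm_step[OF b A Q lpos Ppos alg])
    have zk: "z k = (renorm_step A ^^ k) (z 0)" for k by (induction k) (simp_all add: zSuc)
    have sub: "subspace (eigenspace A r)" for r
      by (auto simp: subspace_def eigenspace_def matrix_vector_right_distrib matrix_vector_mult_scaleR
          scaleR_add_right)
    have nz: "\<exists>i. l i = r \<and> z 0 \<bullet> b i \<noteq> 0" if "orth_projector (eigenspace A r) (z 0) \<noteq> 0" for r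
      using orth_projector_nonzeroD[OF that sub] eigenspace_orthonormal[OF b A] by blast
    obtain i j where ij: "l i = m" "z 0 \<bullet> b i \<noteq> 0" "l j = M" "z 0 \<bullet> b j \<noteq> 0"
      using nz[OF Em] nz[OF EM] by blast
    have sum_w: "(\<Sum>i\<in>UNIV. ?w k $ i) = z k \<bullet> z k" for k
      by (subst orthonormal_inner[OF b]) (simp add: coord_weights_def power2_eq_square)
    define n where "n = (\<Sum>j\<in>UNIV. P (l j) * l j * (quad_grad A y (x 0) \<bullet> b j)^2)"
    have z0c: "z 0 \<bullet> b i = sqrt (P (l i) * l i) * (quad_grad A y (x 0) \<bullet> b i) / sqrt n" for i
      unfolding z n_def by (rule renorm_grad_coords[OF b A Q lpos Ppos])
    have "n \<ge> 0" unfolding n_def using Ppos lpos by (intro sum_nonneg mult_nonneg_nonneg) (auto simp: less_imp_le)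
    \<comment> \<open>With \<open>n = 0\<close> the convention for division by zero would give
      \<open>z 0 = 0\<close>, against the nonzero projections.\<close>
    moreover have "n \<noteq> 0" using ij(2) z0c by auto
    ultimately have n: "n > 0" by simp
    have "(\<Sum>i\<in>UNIV. ?w 0 $ i) = (\<Sum>i\<in>UNIV. P (l i) * l i * (quad_grad A y (x 0) \<bullet> b i)^2 / n)"
      using n Ppos lpos
      by (intro sum.cong) (auto simp: coord_weights_def z0c power_mult_distrib power_divide less_imp_le)
    hence sum0: "(\<Sum>i\<in>UNIV. ?w 0 $ i) = 1" using n by (simp add: sum_divide_distrib[symmetric] n_def[symmetric])
    have var_nonneg: "weight_var l (?w k) \<ge> 0" for k
      unfolding weight_var_def coord_weights_def by (intro sum_nonneg) simp
    interpret weight_iteration l m M ?w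
    proof
      show "?w (Suc k) $ i = (l i - weight_mean l (?w k))^2 / weight_var l (?w k) * ?w k $ i" for k i
        unfolding zSuc A coord_weights_def[of b "renorm_step _ _"] vec_lambda_beta renorm_step_coords[OF b]
        using var_nonneg[of k]
        by (simp add: power_divide power_mult_distrib coord_weights_def[of b "z k"] power2_commute)
      show "\<exists>i. l i = m \<and> ?w 0 $ i > 0" "\<exists>i. l i = M \<and> ?w 0 $ i > 0"
        using ij by (auto simp: coord_weights_def)
    qed (use l assms(7) sum0 in \<open>auto simp: coord_weights_def\<close>)
    obtain q where q: "0 < q" "q < 1"
      and lims: "(\<lambda>k. weight_at l m (?w (2 * k))) \<longlonglongrightarrow> q" "(\<lambda>k. weight_at l M (?w (2 * k))) \<longlonglongrightarrow> 1 - q"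
        "(\<lambda>k. weight_at l m (?w (Suc (2 * k)))) \<longlonglongrightarrow> 1 - q" "(\<lambda>k. weight_at l M (?w (Suc (2 * k)))) \<longlonglongrightarrow> q"
      using weights_tendsto by blast
    have pq: "p (z 0) = q" unfolding p_def zk[symmetric] using lims(1) by (rule limI)
    have norm_z: "norm (z k) = 1" for k
      using sum_w[of k] w_sum[of k] by (simp add: norm_eq_sqrt_inner)
    have "i \<noteq> j" using ij assms(7) by auto
    hence "card {i, j} = 2" by simp
    hence dim: "CARD('n) \<ge> 2" using card_mono[of UNIV "{i, j}"] by simp
    have mM: "m \<noteq> M" using assms(7) by simp
    obtain u0 v0 where e: "\<And>k. z (2 * k) = sqrt q *\<^sub>R u0 k + sqrt (1 - q) *\<^sub>R v0 k"
      "\<And>k. norm (u0 k) = 1" "\<And>k. norm (v0 k) = 1"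
      "(\<lambda>k. A *v u0 k - m *\<^sub>R u0 k) \<longlonglongrightarrow> 0" "(\<lambda>k. A *v v0 k - M *\<^sub>R v0 k) \<longlonglongrightarrow> 0"
      using two_point_decomposition[OF b mM dim q norm_z lims(1,2), folded A] by blast
    have q': "0 < 1 - q" "1 - q < 1" using q by auto
    have lims': "(\<lambda>k. weight_at l M (?w (Suc (2 * k)))) \<longlonglongrightarrow> 1 - (1 - q)" using lims(4) by simp
    \<comment> \<open>At odd indices the limit masses are exchanged, so the decomposition is taken
      with \<open>1 - q\<close>. Negating \<open>v1\<close> then produces the required minus
      sign.\<close>
    obtain u1 v1 where o: "\<And>k. z (Suc (2 * k)) = sqrt (1 - q) *\<^sub>R u1 k + sqrt (1 - (1 - q)) *\<^sub>R v1 k"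
      "\<And>k. norm (u1 k) = 1" "\<And>k. norm (v1 k) = 1"
      "(\<lambda>k. A *v u1 k - m *\<^sub>R u1 k) \<longlonglongrightarrow> 0" "(\<lambda>k. A *v v1 k - M *\<^sub>R v1 k) \<longlonglongrightarrow> 0"
      using two_point_decomposition[OF b mM dim q' norm_z lims(3) lims', folded A] by blast
    define u where "u n = (if even n then u0 (n div 2) else u1 (n div 2))" for n
    define v where "v n = (if even n then v0 (n div 2) else - v1 (n div 2))" for n
    have "(\<lambda>n. A *v u n - m *\<^sub>R u n) \<longlonglongrightarrow> 0"
      by (rule tendsto_even_odd) (use e o in \<open>simp_all add: u_def\<close>)
    moreover have "(\<lambda>n. A *v v n - M *\<^sub>R v n) \<longlonglongrightarrow> 0"
    proof (rule tendsto_even_odd)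
      have "(\<lambda>k. - (A *v v1 k - M *\<^sub>R v1 k)) \<longlonglongrightarrow> - 0" by (intro tendsto_intros o)
      moreover have "A *v (- v1 k) = - (A *v v1 k)" for k
        using matrix_vector_mult_scaleR[of A "-1" "v1 k"] by simp
      ultimately show "(\<lambda>k. A *v v (Suc (2 * k)) - M *\<^sub>R v (Suc (2 * k))) \<longlonglongrightarrow> 0"
        by (simp add: v_def)
    qed (use e in \<open>simp add: v_def\<close>)
    ultimately show ?thesis
      unfolding pq using q e(1-3) o(1-3)
      by (intro conjI exI[of _ u] exI[of _ v] tendsto_norm_zero) (auto simp: u_def v_def)
  qed
  show ?thesis
    by (intro exI[of _ p] allI impI, elim conjE, rule main) (auto simp: Q_def)
qed

end
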